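(* Let $\mathcal{A}$ be an abelian category or, more generally, a weakly idempotent complete exact category. Let $(\mathcal{Q}, \widetilde{\mathcal{R}})$ and $(\widetilde{\mathcal{Q}}, \mathcal{R})$ be two complete hereditary cotorsion pairs in $\mathcal{A}$ satisfying (1) $\widetilde{\mathcal{R}} \subseteq \mathcal{R}$ and $\widetilde{\mathcal{Q}} \subseteq \mathcal{Q}$; (2) $\widetilde{\mathcal{Q}} \cap \mathcal{R} = \mathcal{Q} \cap \widetilde{\mathcal{R}}$. Then there is a unique thick class $\mathcal{W}$ of objects of $\mathcal{A}$ for which $(\mathcal{Q}, \mathcal{W}, \mathcal{R})$ is a Hovey triple. Moreover, this thick class $\mathcal{W}$ can be described in the two following ways: \begin{align*} \mathcal{W} &= \{\, X \in \mathcal{A} \mid \text{there exists a short exact sequence } X \rightarrowtail R \twoheadrightarrow Q \text{ with } R \in \widetilde{\mathcal{R}},\ Q \in \widetilde{\mathcal{Q}} \,\} \\ &= \{\, X \in \mathcal{A} \mid \text{there exists a short exact sequence } R' \rightarrowtail Q' \twoheadrightarrow X \text{ with } R' \in \widetilde{\mathcal{R}},\ Q' \in \widetilde{\mathcal{Q}} \,\}. \end{align*}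
   Context: Exact categories are in the sense of Quillen. An exact category is weakly idempotent complete if every split monomorphism has a cokernel (equivalently, every split epimorphism has a kernel). "Short exact sequence" means a sequence $A \rightarrowtail B \twoheadrightarrow C$ in the exact structure (in the abelian case, an ordinary short exact sequence), $\rightarrowtail$ denotes an admissible monomorphism, $\twoheadrightarrow$ an admissible epimorphism, and $\operatorname{Ext}^1_{\mathcal{A}}$ is the Yoneda Ext group of short exact sequences. In the abelian case these are ordinary monomorphisms and epimorphisms. A pair $(\mathcal{C}, \mathcal{F})$ of classes of objects of $\mathcal{A}$ is a cotorsion pair if $\mathcal{F} = \{\, F \mid \operatorname{Ext}^1_{\mathcal{A}}(C,F)=0 \text{ for all } C \in \mathcal{C} \,\}$ and $\mathcal{C} = \{\, C \mid \operatorname{Ext}^1_{\mathcal{A}}(C,F)=0 \text{ for all } F \in \mathcal{F} \,\}$. It is complete if for every object $A$ of $\mathcal{A}$ there are short exact sequences $F \rightarrowtail C \twoheadrightarrow A$ (enough projectives) and $A \rightarrowtail F' \twoheadrightarrow C'$ (enough injectives) with $C, C' \in \mathcal{C}$ and $F, F' \in \mathcal{F}$. It is hereditary if $\mathcal{C}$ is closed under taking kernels of (admissible) epimorphisms between objects of $\mathcal{C}$ and $\mathcal{F}$ is closed under taking cokernels of (admissible) monomorphisms between objects of $\mathcal{F}$. A class $\mathcal{W}$ of objects of $\mathcal{A}$ is thick if it is closed under retracts and whenever two out of the three terms in a short exact sequence $X \rightarrowtail Y \twoheadrightarrow Z$ are in $\mathcal{W}$, so is the third. A Hovey triple is a triple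 $(\mathcal{Q}, \mathcal{W}, \mathcal{R})$ of classes of objects of $\mathcal{A}$ such that $\mathcal{W}$ is thick and both $(\mathcal{Q}, \mathcal{W} \cap \mathcal{R})$ and $(\mathcal{Q} \cap \mathcal{W}, \mathcal{R})$ are complete cotorsion pairs. The symbols $\widetilde{\mathcal{Q}}$ and $\widetilde{\mathcal{R}}$ are just names for the given classes; no relation to $\mathcal{Q}$, $\mathcal{R}$ is assumed beyond what is stated. *)

theory Defs
  imports "HOL-Algebra.Group"
begin

section \<open>Additive categories\<close>

text \<open>
  Composition is written in applicative order: \<open>g \<cdot> f\<close> is ``first \<open>f\<close>, then \<open>g\<close>''.  The addition is
  only meaningful on parallel morphisms.
\<close>

record ('o, 'm) cat_data =
  Obj :: "'o set"
  Mor :: "'m set"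
  Dom :: "'m \<Rightarrow> 'o"
  Cod :: "'m \<Rightarrow> 'o"
  idm :: "'o \<Rightarrow> 'm"
  cmp :: "'m \<Rightarrow> 'm \<Rightarrow> 'm"  (infixl "\<cdot>\<index>" 70)

record ('o, 'm) preadd_data = "('o, 'm) cat_data" +
  addm :: "'m \<Rightarrow> 'm \<Rightarrow> 'm"
  zerom :: "'o \<Rightarrow> 'o \<Rightarrow> 'm"

definition homs :: "('o, 'm, 'z) cat_data_scheme \<Rightarrow> 'o \<Rightarrow> 'o \<Rightarrow> 'm set" where
  "homs A X Y = {f \<in> Mor A. Dom A f = X \<and> Cod A f = Y}"

locale precategory =
  fixes A :: "('o, 'm, 'z) cat_data_scheme" (structure)
  assumes dom_obj: "f \<in> Mor A \<Longrightarrow> Dom A f \<in> Obj A"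
    and cod_obj: "f \<in> Mor A \<Longrightarrow> Cod A f \<in> Obj A"
    and id_hom: "X \<in> Obj A \<Longrightarrow> idm A X \<in> homs A X X"
    and cmp_hom: "\<lbrakk>f \<in> homs A X Y; g \<in> homs A Y Z\<rbrakk> \<Longrightarrow> g \<cdot> f \<in> homs A X Z"
    and cmp_id_right: "f \<in> homs A X Y \<Longrightarrow> f \<cdot> idm A X = f"
    and cmp_id_left: "f \<in> homs A X Y \<Longrightarrow> idm A Y \<cdot> f = f"
    and cmp_assoc: "\<lbrakk>f \<in> homs A W X; g \<in> homs A X Y; h \<in> homs A Y Z\<rbrakk>
      \<Longrightarrow> (h \<cdot> g) \<cdot> f = h \<cdot> (g \<cdot> f)"

locale preadditive_category = precategory A
  for A :: "('o, 'm, 'z) preadd_data_scheme" (structure) +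
  assumes hom_group: "\<lbrakk>X \<in> Obj A; Y \<in> Obj A\<rbrakk>
      \<Longrightarrow> comm_group \<lparr>carrier = homs A X Y, mult = addm A, one = zerom A X Y\<rparr>"
    and cmp_add_right: "\<lbrakk>f \<in> homs A X Y; f' \<in> homs A X Y; g \<in> homs A Y Z\<rbrakk>
      \<Longrightarrow> g \<cdot> addm A f f' = addm A (g \<cdot> f) (g \<cdot> f')"
    and cmp_add_left: "\<lbrakk>f \<in> homs A X Y; g \<in> homs A Y Z; g' \<in> homs A Y Z\<rbrakk>
      \<Longrightarrow> addm A g g' \<cdot> f = addm A (g \<cdot> f) (g' \<cdot> f)"

definition zero_object :: "('o, 'm, 'z) cat_data_scheme \<Rightarrow> 'o \<Rightarrow> bool" where
  "zero_object A N \<longleftrightarrow> N \<in> Obj A \<and>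
     (\<forall>X \<in> Obj A. (\<exists>!f. f \<in> homs A N X) \<and> (\<exists>!f. f \<in> homs A X N))"

definition biproduct ::
  "('o, 'm, 'z) preadd_data_scheme \<Rightarrow> 'o \<Rightarrow> 'o \<Rightarrow> 'o \<Rightarrow> 'm \<Rightarrow> 'm \<Rightarrow> 'm \<Rightarrow> 'm \<Rightarrow> bool" where
  "biproduct A X Y S i1 i2 p1 p2 \<longleftrightarrow>
     S \<in> Obj A \<and> i1 \<in> homs A X S \<and> i2 \<in> homs A Y S \<and> p1 \<in> homs A S X \<and> p2 \<in> homs A S Y \<and>
     cmp A p1 i1 = idm A X \<and> cmp A p2 i2 = idm A Y \<and>
     cmp A p1 i2 = zerom A Y X \<and> cmp A p2 i1 = zerom A X Y \<and>
     addm A (cmp A i1 p1) (cmp A i2 p2) = idm A S"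

locale additive_category = preadditive_category A
  for A :: "('o, 'm, 'z) preadd_data_scheme" (structure) +
  assumes ex_zero_object: "\<exists>N. zero_object A N"
    and ex_biproduct: "\<lbrakk>X \<in> Obj A; Y \<in> Obj A\<rbrakk>
      \<Longrightarrow> \<exists>S i1 i2 p1 p2. biproduct A X Y S i1 i2 p1 p2"

definition iso_mor :: "('o, 'm, 'z) cat_data_scheme \<Rightarrow> 'o \<Rightarrow> 'o \<Rightarrow> 'm \<Rightarrow> bool" where
  "iso_mor A X Y f \<longleftrightarrow> f \<in> homs A X Y \<and>
     (\<exists>g \<in> homs A Y X. cmp A g f = idm A X \<and> cmp A f g = idm A Y)"

definition is_kernel :: "('o, 'm, 'z) preadd_data_scheme \<Rightarrow> 'm \<Rightarrow> 'm \<Rightarrow> bool" where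
  "is_kernel A f k \<longleftrightarrow>
     f \<in> Mor A \<and> k \<in> Mor A \<and> Cod A k = Dom A f \<and>
     cmp A f k = zerom A (Dom A k) (Cod A f) \<and>
     (\<forall>g \<in> Mor A. Cod A g = Dom A f \<and> cmp A f g = zerom A (Dom A g) (Cod A f) \<longrightarrow>
        (\<exists>!h. h \<in> homs A (Dom A g) (Dom A k) \<and> cmp A k h = g))"

definition is_cokernel :: "('o, 'm, 'z) preadd_data_scheme \<Rightarrow> 'm \<Rightarrow> 'm \<Rightarrow> bool" where
  "is_cokernel A f c \<longleftrightarrow>
     f \<in> Mor A \<and> c \<in> Mor A \<and> Dom A c = Cod A f \<and>
     cmp A c f = zerom A (Dom A f) (Cod A c) \<and>
     (\<forall>g \<in> Mor A. Dom A g = Cod A f \<and> cmp A g f = zerom A (Dom A f) (Cod A g) \<longrightarrow>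
        (\<exists>!h. h \<in> homs A (Cod A c) (Cod A g) \<and> cmp A h c = g))"

definition split_mono :: "('o, 'm, 'z) cat_data_scheme \<Rightarrow> 'm \<Rightarrow> bool" where
  "split_mono A s \<longleftrightarrow> s \<in> Mor A \<and>
     (\<exists>r \<in> homs A (Cod A s) (Dom A s). cmp A r s = idm A (Dom A s))"

definition is_pushout ::
  "('o, 'm, 'z) cat_data_scheme \<Rightarrow> 'm \<Rightarrow> 'm \<Rightarrow> 'm \<Rightarrow> 'm \<Rightarrow> bool" where
  \<comment> \<open>\<open>i' : X' \<rightarrow> P\<close> and \<open>f' : Y \<rightarrow> P\<close> form a pushout of \<open>i : X \<rightarrow> Y\<close> and \<open>f : X \<rightarrow> X'\<close>\<close>
  "is_pushout A i f i' f' \<longleftrightarrow>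
     i \<in> Mor A \<and> f \<in> Mor A \<and> i' \<in> Mor A \<and> f' \<in> Mor A \<and>
     Dom A i = Dom A f \<and> Dom A i' = Cod A f \<and> Dom A f' = Cod A i \<and> Cod A i' = Cod A f' \<and>
     cmp A i' f = cmp A f' i \<and>
     (\<forall>u \<in> Mor A. \<forall>v \<in> Mor A. Dom A u = Cod A f \<and> Dom A v = Cod A i \<and> Cod A u = Cod A v \<and>
          cmp A u f = cmp A v i \<longrightarrow>
        (\<exists>!h. h \<in> homs A (Cod A i') (Cod A u) \<and> cmp A h i' = u \<and> cmp A h f' = v))"

definition is_pullback ::
  "('o, 'm, 'z) cat_data_scheme \<Rightarrow> 'm \<Rightarrow> 'm \<Rightarrow> 'm \<Rightarrow> 'm \<Rightarrow> bool" where
  \<comment> \<open>\<open>p' : P \<rightarrow> Z'\<close> and \<open>f' : P \<rightarrow> Y\<close> form a pullback of \<open>p : Y \<rightarrow> Z\<close> and \<open>f : Z' \<rightarrow> Z\<close>\<close>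
  "is_pullback A p f p' f' \<longleftrightarrow>
     p \<in> Mor A \<and> f \<in> Mor A \<and> p' \<in> Mor A \<and> f' \<in> Mor A \<and>
     Cod A p = Cod A f \<and> Cod A p' = Dom A f \<and> Cod A f' = Dom A p \<and> Dom A p' = Dom A f' \<and>
     cmp A f p' = cmp A p f' \<and>
     (\<forall>u \<in> Mor A. \<forall>v \<in> Mor A. Cod A u = Dom A f \<and> Cod A v = Dom A p \<and> Dom A u = Dom A v \<and>
          cmp A f u = cmp A p v \<longrightarrow>
        (\<exists>!h. h \<in> homs A (Dom A u) (Dom A p') \<and> cmp A p' h = u \<and> cmp A f' h = v))"


section \<open>Exact categories\<close>

text \<open>
  \<open>Ses\<close> is the class of short exact sequences \<open>(i, p)\<close>.  The axioms below are the usual minimal form of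
  Quillen's: his ``obscure'' axiom on morphisms that possess a (co)kernel, and the exactness of
  split sequences, follow from them.  An abelian category is the case in which \<open>Ses\<close> consists of
  all kernel-cokernel pairs.
\<close>

record ('o, 'm) exact_data = "('o, 'm) preadd_data" +
  Ses :: "('m \<times> 'm) set"

definition adm_mono :: "('o, 'm, 'z) exact_data_scheme \<Rightarrow> 'm \<Rightarrow> bool" where
  "adm_mono A i \<longleftrightarrow> (\<exists>p. (i, p) \<in> Ses A)"

definition adm_epi :: "('o, 'm, 'z) exact_data_scheme \<Rightarrow> 'm \<Rightarrow> bool" where
  "adm_epi A p \<longleftrightarrow> (\<exists>i. (i, p) \<in> Ses A)"

locale exact_category = additive_category A
  for A :: "('o, 'm, 'z) exact_data_scheme" (structure) +
  assumes ses_kernel: "(i, p) \<in> Ses A \<Longrightarrow> is_kernel A p i"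
    and ses_cokernel: "(i, p) \<in> Ses A \<Longrightarrow> is_cokernel A i p"
    and ses_iso_closed:
      "\<lbrakk>(i, p) \<in> Ses A; i \<in> homs A X Y; p \<in> homs A Y Z;
        i' \<in> homs A X' Y'; p' \<in> homs A Y' Z';
        iso_mor A X X' a; iso_mor A Y Y' b; iso_mor A Z Z' c;
        b \<cdot> i = i' \<cdot> a; c \<cdot> p = p' \<cdot> b\<rbrakk> \<Longrightarrow> (i', p') \<in> Ses A"
    and id_adm_mono: "X \<in> Obj A \<Longrightarrow> adm_mono A (idm A X)"
    and id_adm_epi: "X \<in> Obj A \<Longrightarrow> adm_epi A (idm A X)"
    and cmp_adm_mono: "\<lbrakk>adm_mono A i; adm_mono A j; Cod A i = Dom A j\<rbrakk> \<Longrightarrow> adm_mono A (j \<cdot> i)"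
    and cmp_adm_epi: "\<lbrakk>adm_epi A p; adm_epi A q; Cod A p = Dom A q\<rbrakk> \<Longrightarrow> adm_epi A (q \<cdot> p)"
    and pushout_adm_mono: "\<lbrakk>adm_mono A i; f \<in> Mor A; Dom A f = Dom A i\<rbrakk>
      \<Longrightarrow> \<exists>i' f'. is_pushout A i f i' f' \<and> adm_mono A i'"
    and pullback_adm_epi: "\<lbrakk>adm_epi A p; f \<in> Mor A; Cod A f = Cod A p\<rbrakk>
      \<Longrightarrow> \<exists>p' f'. is_pullback A p f p' f' \<and> adm_epi A p'"

locale wic_exact_category = exact_category A
  for A :: "('o, 'm, 'z) exact_data_scheme" (structure) +
  assumes split_mono_has_cokernel: "split_mono A s \<Longrightarrow> \<exists>c. is_cokernel A s c"

definition short_exact ::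
  "('o, 'm, 'z) exact_data_scheme \<Rightarrow> 'o \<Rightarrow> 'o \<Rightarrow> 'o \<Rightarrow> bool" where
  \<comment> \<open>there is a short exact sequence \<open>X \<rightarrow> Y \<rightarrow> Z\<close>\<close>
  "short_exact A X Y Z \<longleftrightarrow> (\<exists>i \<in> homs A X Y. \<exists>p \<in> homs A Y Z. (i, p) \<in> Ses A)"


section \<open>Yoneda Ext\<close>

text \<open>
  \<open>Ext\<^sup>1(C, F)\<close> is the set of short exact sequences \<open>F \<rightarrow> B \<rightarrow> C\<close> modulo equivalence.  Of its group
  structure (Baer sum) only the neutral element, the class of the split sequence
  \<open>F \<rightarrow> F \<oplus> C \<rightarrow> C\<close>, matters for the vanishing of the group.
\<close>

definition extensions :: "('o, 'm, 'z) exact_data_scheme \<Rightarrow> 'o \<Rightarrow> 'o \<Rightarrow> ('m \<times> 'm) set" where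
  "extensions A C F = {(i, p) \<in> Ses A. Dom A i = F \<and> Cod A p = C}"

definition ext_equiv ::
  "('o, 'm, 'z) exact_data_scheme \<Rightarrow> 'o \<Rightarrow> 'o \<Rightarrow> (('m \<times> 'm) \<times> ('m \<times> 'm)) set" where
  "ext_equiv A C F = {((i, p), (i', p')).
     (i, p) \<in> extensions A C F \<and> (i', p') \<in> extensions A C F \<and>
     (\<exists>b. iso_mor A (Cod A i) (Cod A i') b \<and> cmp A b i = i' \<and> cmp A p' b = p)}"

definition Ext1 :: "('o, 'm, 'z) exact_data_scheme \<Rightarrow> 'o \<Rightarrow> 'o \<Rightarrow> ('m \<times> 'm) set set" where
  "Ext1 A C F = extensions A C F // ext_equiv A C F"

definition Ext1_zero :: "('o, 'm, 'z) exact_data_scheme \<Rightarrow> 'o \<Rightarrow> 'o \<Rightarrow> ('m \<times> 'm) set" where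
  \<comment> \<open>all choices of the biproduct give the same class\<close>
  "Ext1_zero A C F =
     {e. \<exists>S i1 i2 p1 p2. biproduct A F C S i1 i2 p1 p2 \<and> ((i1, p2), e) \<in> ext_equiv A C F}"

definition Ext1_vanishes :: "('o, 'm, 'z) exact_data_scheme \<Rightarrow> 'o \<Rightarrow> 'o \<Rightarrow> bool" where
  "Ext1_vanishes A C F \<longleftrightarrow> Ext1 A C F = {Ext1_zero A C F}"


section \<open>Cotorsion pairs and Hovey triples\<close>

definition cotorsion_pair ::
  "('o, 'm, 'z) exact_data_scheme \<Rightarrow> 'o set \<Rightarrow> 'o set \<Rightarrow> bool" where
  "cotorsion_pair A \<C> \<F> \<longleftrightarrow>
     \<C> \<subseteq> Obj A \<and> \<F> \<subseteq> Obj A \<and>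
     \<F> = {F \<in> Obj A. \<forall>C \<in> \<C>. Ext1_vanishes A C F} \<and>
     \<C> = {C \<in> Obj A. \<forall>F \<in> \<F>. Ext1_vanishes A C F}"

definition complete_pair ::
  "('o, 'm, 'z) exact_data_scheme \<Rightarrow> 'o set \<Rightarrow> 'o set \<Rightarrow> bool" where
  "complete_pair A \<C> \<F> \<longleftrightarrow>
     (\<forall>X \<in> Obj A. (\<exists>F \<in> \<F>. \<exists>C \<in> \<C>. short_exact A F C X) \<and>
                  (\<exists>F' \<in> \<F>. \<exists>C' \<in> \<C>. short_exact A X F' C'))"

definition hereditary_pair ::
  "('o, 'm, 'z) exact_data_scheme \<Rightarrow> 'o set \<Rightarrow> 'o set \<Rightarrow> bool" where
  "hereditary_pair A \<C> \<F> \<longleftrightarrow>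
     (\<forall>X Y Z. short_exact A X Y Z \<longrightarrow> Y \<in> \<C> \<longrightarrow> Z \<in> \<C> \<longrightarrow> X \<in> \<C>) \<and>
     (\<forall>X Y Z. short_exact A X Y Z \<longrightarrow> X \<in> \<F> \<longrightarrow> Y \<in> \<F> \<longrightarrow> Z \<in> \<F>)"

definition complete_cotorsion_pair ::
  "('o, 'm, 'z) exact_data_scheme \<Rightarrow> 'o set \<Rightarrow> 'o set \<Rightarrow> bool" where
  "complete_cotorsion_pair A \<C> \<F> \<longleftrightarrow> cotorsion_pair A \<C> \<F> \<and> complete_pair A \<C> \<F>"

definition is_retract :: "('o, 'm, 'z) cat_data_scheme \<Rightarrow> 'o \<Rightarrow> 'o \<Rightarrow> bool" where
  \<comment> \<open>\<open>X\<close> is a retract of \<open>Y\<close>\<close>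
  "is_retract A X Y \<longleftrightarrow> (\<exists>s \<in> homs A X Y. \<exists>r \<in> homs A Y X. cmp A r s = idm A X)"

definition thick :: "('o, 'm, 'z) exact_data_scheme \<Rightarrow> 'o set \<Rightarrow> bool" where
  "thick A \<W> \<longleftrightarrow>
     \<W> \<subseteq> Obj A \<and>
     (\<forall>X Y. is_retract A X Y \<longrightarrow> Y \<in> \<W> \<longrightarrow> X \<in> \<W>) \<and>
     (\<forall>X Y Z. short_exact A X Y Z \<longrightarrow>
        (X \<in> \<W> \<and> Y \<in> \<W> \<longrightarrow> Z \<in> \<W>) \<and>
        (X \<in> \<W> \<and> Z \<in> \<W> \<longrightarrow> Y \<in> \<W>) \<and>
        (Y \<in> \<W> \<and> Z \<in> \<W> \<longrightarrow> X \<in> \<W>))"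

definition Hovey_triple ::
  "('o, 'm, 'z) exact_data_scheme \<Rightarrow> 'o set \<Rightarrow> 'o set \<Rightarrow> 'o set \<Rightarrow> bool" where
  "Hovey_triple A \<Q> \<W> \<R> \<longleftrightarrow>
     thick A \<W> \<and>
     complete_cotorsion_pair A \<Q> (\<W> \<inter> \<R>) \<and>
     complete_cotorsion_pair A (\<Q> \<inter> \<W>) \<R>"

end

theory Submission
  imports Defs
begin

text \<open>
  Uniqueness is the easy half.  A cotorsion pair is determined by either of its classes, so a Hovey
  triple \<open>(\<Q>, \<W>, \<R>)\<close> of the required kind must satisfy \<open>\<W> \<inter> \<R> = \<R>t\<close> and \<open>\<Q> \<inter> \<W> = \<Q>t\<close>.  Embed an
  arbitrary \<open>X\<close> by enough injectives of \<open>(\<Q>t, \<R>)\<close> as \<open>X \<rightarrow> R \<rightarrow> Q\<close> with \<open>R \<in> \<R>\<close> and \<open>Q \<in> \<Q>t \<subseteq> \<W>\<close>.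
  Two out of three says that \<open>X \<in> \<W>\<close> iff \<open>R \<in> \<W>\<close>, that is, iff \<open>R \<in> \<R>t\<close>.  This forces the first
  description of \<open>\<W>\<close>, called \<open>trivials\<close> below (its members are the trivial objects); the
  second one, \<open>cotrivials\<close>, is its dual.

  Existence means showing that \<open>trivials\<close> works.  Except for retracts, everything is done
  with four moves on short exact sequences: the Noether isomorphism for a composite of two admissible monomorphisms
  (\<open>short_exact_composite_mono\<close>), the pushout of two short exact sequences along each other
  (\<open>short_exact_pushout\<close>), and the duals of these two.  The classes of a cotorsion pair are closed
  under extensions, they are hereditary by assumption, and \<open>\<Q>t \<inter> \<R> = \<Q> \<inter> \<R>t\<close> allows one to pass from
  one pair to the other.

  \<^item> \<open>trivials = cotrivials\<close>: from \<open>X \<rightarrow> R \<rightarrow> Q\<close> choose \<open>R' \<rightarrow> Q' \<rightarrow> R\<close>.  Then \<open>Q'\<close> lies in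
    \<open>\<Q> \<inter> \<R>t = \<Q>t \<inter> \<R>\<close>, and the kernel \<open>K\<close> of \<open>Q' \<rightarrow> R \<rightarrow> Q\<close> lies in \<open>\<Q>t\<close> and covers \<open>X\<close> with
    kernel \<open>R'\<close>.
  \<^item> Two out of three: an extension \<open>Y\<close> of trivial objects \<open>X\<close> and \<open>Z\<close> can be changed, by a pushout
    on the left and a pullback on the right, into an extension of an object of \<open>\<Q>t\<close> by an object of
    \<open>\<R>t\<close>, which is trivial; the change costs one kernel onto \<open>\<Q>t\<close> and one cokernel from \<open>\<R>t\<close>, and
    these two preserve triviality by the Noether isomorphism.  A pushout reduces general cokernels
    to extensions and to cokernels from \<open>\<R>t\<close>; kernels are dual.
  \<^item> Retracts: if \<open>X\<close> is a retract of a trivial \<open>Y\<close>, then in \<open>X \<rightarrow> R \<rightarrow> Q\<close> the object \<open>R\<close> is a retract of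
    a trivial object of \<open>\<R>\<close>, hence of an object of \<open>\<R>t\<close>, and \<open>\<R>t\<close> is closed under retracts.
  \<^item> \<open>\<Q> \<inter> trivials = \<Q>t\<close> and dually \<open>trivials \<inter> \<R> = \<R>t\<close>, so that the two given cotorsion pairs are the
    ones demanded of a Hovey triple.

  The hypotheses are invariant under passage to the opposite category with the exchange of \<open>\<Q>\<close>
  and \<open>\<R>\<close>, so half of the statements come for free.  The vanishing of \<open>Ext\<^sup>1(C, F)\<close> enters only
  through the equivalent condition that every short exact sequence \<open>F \<rightarrow> B \<rightarrow> C\<close> has a section
  (\<open>Ext1_vanishes_iff_section\<close>), which is self-dual and yields the lifting and extension properties.
\<close>

section \<open>Composition and addition of morphisms\<close>

text \<open>
  The axioms speak of membership in a hom-set, whose endpoints cannot be read off from a composite.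
  Below they are restated in terms of \<^const>\<open>Dom\<close> and \<^const>\<open>Cod\<close>, so that every
  side condition is an equation between endpoints that rewriting decides by itself.
\<close>

context precategory
begin

lemma dom_obj' [simp]: "f \<in> Mor A \<Longrightarrow> Dom A f \<in> Obj A"
  by (rule dom_obj)

lemma cod_obj' [simp]: "f \<in> Mor A \<Longrightarrow> Cod A f \<in> Obj A"
  by (rule cod_obj)

lemma id_mor [simp]:
  assumes "X \<in> Obj A"
  shows "idm A X \<in> Mor A" "Dom A (idm A X) = X" "Cod A (idm A X) = X"
  using id_hom[OF assms] by (auto simp: homs_def)

lemma cmp_mor [simp]:
  assumes "f \<in> Mor A" "g \<in> Mor A" "Dom A g = Cod A f"
  shows "g \<cdot> f \<in> Mor A" "Dom A (g \<cdot> f) = Dom A f" "Cod A (g \<cdot> f) = Cod A g"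
  using cmp_hom[of f "Dom A f" "Cod A f" g "Cod A g"] assms by (auto simp: homs_def)

lemma cmp_assoc_mor [simp]:
  assumes "f \<in> Mor A" "g \<in> Mor A" "h \<in> Mor A" "Dom A g = Cod A f" "Dom A h = Cod A g"
  shows "(h \<cdot> g) \<cdot> f = h \<cdot> (g \<cdot> f)"
  using cmp_assoc[of f "Dom A f" "Cod A f" g "Cod A g" h "Cod A h"] assms
  by (auto simp: homs_def)

lemma cmp_id_mor [simp]:
  assumes "f \<in> Mor A"
  shows "Dom A f = X \<Longrightarrow> f \<cdot> idm A X = f" "Cod A f = Y \<Longrightarrow> idm A Y \<cdot> f = f"
  using cmp_id_right[of f X "Cod A f"] cmp_id_left[of f "Dom A f" Y] assms
  by (auto simp: homs_def)

text \<open>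
  Rewriting associates composites to the right; this lemma uses a known composite \<open>h \<cdot> g\<close> that has
  thereby disappeared into \<open>h \<cdot> (g \<cdot> f)\<close>.
\<close>

lemma cmp_cong_assoc:
  assumes "h \<cdot> g = k" "f \<in> Mor A" "g \<in> Mor A" "h \<in> Mor A" "Dom A g = Cod A f" "Dom A h = Cod A g"
  shows "h \<cdot> (g \<cdot> f) = k \<cdot> f"
  using assms cmp_assoc_mor by metis

end

context preadditive_category
begin

lemma
  assumes "X \<in> Obj A" "Y \<in> Obj A"
  shows zero_hom: "zerom A X Y \<in> homs A X Y"
    and add_hom: "\<And>f g. \<lbrakk>f \<in> homs A X Y; g \<in> homs A X Y\<rbrakk> \<Longrightarrow> addm A f g \<in> homs A X Y"
    and add_zero_left: "\<And>f. f \<in> homs A X Y \<Longrightarrow> addm A (zerom A X Y) f = f"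
    and add_zero_right: "\<And>f. f \<in> homs A X Y \<Longrightarrow> addm A f (zerom A X Y) = f"
    and add_eq_right: "\<And>f g. \<lbrakk>f \<in> homs A X Y; g \<in> homs A X Y; addm A f g = g\<rbrakk>
      \<Longrightarrow> f = zerom A X Y"
    and add_solve: "\<And>f g. \<lbrakk>f \<in> homs A X Y; g \<in> homs A X Y\<rbrakk>
      \<Longrightarrow> \<exists>d \<in> homs A X Y. addm A d f = g"
proof -
  let ?G = "\<lparr>carrier = homs A X Y, mult = addm A, one = zerom A X Y\<rparr>"
  interpret G: comm_group ?G by (rule hom_group[OF assms])
  show "zerom A X Y \<in> homs A X Y" using G.one_closed by simp
  show "addm A f g \<in> homs A X Y" if "f \<in> homs A X Y" "g \<in> homs A X Y" for f g
    using G.m_closed that by simp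
  show "addm A (zerom A X Y) f = f" if "f \<in> homs A X Y" for f
    using G.l_one that by simp
  show "addm A f (zerom A X Y) = f" if "f \<in> homs A X Y" for f
    using G.r_one that by simp
  show "f = zerom A X Y" if "f \<in> homs A X Y" "g \<in> homs A X Y" "addm A f g = g" for f g
    using G.r_cancel_one'[of g f] that by simp
  show "\<exists>d \<in> homs A X Y. addm A d f = g" if f: "f \<in> homs A X Y" and g: "g \<in> homs A X Y" for f g
    using G.inv_solve_right[of g _ f] G.m_closed[of g "m_inv ?G f"] G.inv_closed[of f] f g
      G.m_assoc[of g "m_inv ?G f" f] G.l_inv[of f] G.r_one[of g]
    by (intro bexI[of _ "addm A g (m_inv ?G f)"]) auto
qed

lemma zero_mor [simp]:
  assumes "X \<in> Obj A" "Y \<in> Obj A"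
  shows "zerom A X Y \<in> Mor A" "Dom A (zerom A X Y) = X" "Cod A (zerom A X Y) = Y"
  using zero_hom[OF assms] by (auto simp: homs_def)

lemma add_mor [simp]:
  assumes "f \<in> Mor A" "g \<in> Mor A" "Dom A g = Dom A f" "Cod A g = Cod A f"
  shows "addm A f g \<in> Mor A" "Dom A (addm A f g) = Dom A f" "Cod A (addm A f g) = Cod A f"
  using add_hom[of "Dom A f" "Cod A f" f g] assms by (auto simp: homs_def)

lemma add_zero_mor [simp]:
  assumes "f \<in> Mor A" "Dom A f = X" "Cod A f = Y"
  shows "addm A (zerom A X Y) f = f" "addm A f (zerom A X Y) = f"
  using add_zero_left[of X Y f] add_zero_right[of X Y f] assms by (auto simp: homs_def)

lemma cmp_add_mor [simp]:
  assumes "f \<in> Mor A" "g \<in> Mor A" "Dom A g = Dom A f" "Cod A g = Cod A f" "h \<in> Mor A"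
  shows "Dom A h = Cod A f \<Longrightarrow> h \<cdot> addm A f g = addm A (h \<cdot> f) (h \<cdot> g)"
    and "Cod A h = Dom A f \<Longrightarrow> addm A f g \<cdot> h = addm A (f \<cdot> h) (g \<cdot> h)"
  using cmp_add_right[of f "Dom A f" "Cod A f" g h "Cod A h"]
    cmp_add_left[of h "Dom A h" "Dom A f" f "Cod A f" g] assms
  by (auto simp: homs_def)

lemma cmp_zero [simp]:
  assumes "h \<in> Mor A"
  shows "\<lbrakk>X \<in> Obj A; Dom A h = Y\<rbrakk> \<Longrightarrow> h \<cdot> zerom A X Y = zerom A X (Cod A h)"
    and "\<lbrakk>Y \<in> Obj A; Cod A h = X\<rbrakk> \<Longrightarrow> zerom A X Y \<cdot> h = zerom A (Dom A h) Y"
proof -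
  assume X: "X \<in> Obj A" and h: "Dom A h = Y"
  have Y: "Y \<in> Obj A" using assms h by auto
  have "addm A (h \<cdot> zerom A X Y) (h \<cdot> zerom A X Y) = h \<cdot> addm A (zerom A X Y) (zerom A X Y)"
    using assms X Y h by (subst cmp_add_mor) auto
  also have "\<dots> = h \<cdot> zerom A X Y" using X Y by simp
  finally show "h \<cdot> zerom A X Y = zerom A X (Cod A h)"
    using add_eq_right[of X "Cod A h" "h \<cdot> zerom A X Y" "h \<cdot> zerom A X Y"] assms X Y h
    by (auto simp: homs_def)
next
  assume Y: "Y \<in> Obj A" and h: "Cod A h = X"
  have X: "X \<in> Obj A" using assms h by auto
  have "addm A (zerom A X Y \<cdot> h) (zerom A X Y \<cdot> h) = addm A (zerom A X Y) (zerom A X Y) \<cdot> h"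
    using assms X Y h by (subst cmp_add_mor) auto
  also have "\<dots> = zerom A X Y \<cdot> h" using X Y by simp
  finally show "zerom A X Y \<cdot> h = zerom A (Dom A h) Y"
    using add_eq_right[of "Dom A h" Y "zerom A X Y \<cdot> h" "zerom A X Y \<cdot> h"] assms X Y h
    by (auto simp: homs_def)
qed

end

section \<open>The opposite category\<close>

definition opposite :: "('o, 'm, 'z) exact_data_scheme \<Rightarrow> ('o, 'm, 'z) exact_data_scheme" where
  "opposite A = A\<lparr>Dom := Cod A, Cod := Dom A, cmp := \<lambda>g f. cmp A f g,
     zerom := \<lambda>X Y. zerom A Y X, Ses := {(p, i). (i, p) \<in> Ses A}\<rparr>"

lemma opposite_simps [simp]:
  "Obj (opposite A) = Obj A" "Mor (opposite A) = Mor A" "Dom (opposite A) = Cod A"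
  "Cod (opposite A) = Dom A" "idm (opposite A) = idm A" "cmp (opposite A) g f = cmp A f g"
  "addm (opposite A) = addm A" "zerom (opposite A) X Y = zerom A Y X"
  "(p, i) \<in> Ses (opposite A) \<longleftrightarrow> (i, p) \<in> Ses A"
  "opposite (opposite A) = A"
  by (simp_all add: opposite_def)

lemma opposite_homs [simp]: "homs (opposite A) X Y = homs A Y X"
  by (auto simp: homs_def)

lemma opposite_iso_mor [simp]: "iso_mor (opposite A) X Y f = iso_mor A Y X f"
  by (auto simp: iso_mor_def)

lemma opposite_is_kernel [simp]: "is_kernel (opposite A) f k = is_cokernel A f k"
  by (auto simp: is_kernel_def is_cokernel_def)

lemma opposite_is_cokernel [simp]: "is_cokernel (opposite A) f k = is_kernel A f k"
  by (auto simp: is_kernel_def is_cokernel_def)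

lemma opposite_is_pushout [simp]: "is_pushout (opposite A) i f i' f' = is_pullback A i f i' f'"
  by (simp add: is_pushout_def is_pullback_def)

lemma opposite_is_pullback [simp]: "is_pullback (opposite A) i f i' f' = is_pushout A i f i' f'"
  using opposite_is_pushout[of "opposite A" i f i' f'] by simp

lemma opposite_adm_mono [simp]: "adm_mono (opposite A) f = adm_epi A f"
  by (simp add: adm_mono_def adm_epi_def)

lemma opposite_adm_epi [simp]: "adm_epi (opposite A) f = adm_mono A f"
  by (simp add: adm_mono_def adm_epi_def)

lemma opposite_zero_object [simp]: "zero_object (opposite A) N = zero_object A N"
  by (auto simp: zero_object_def)

lemma opposite_biproduct [simp]:
  "biproduct (opposite A) X Y S i1 i2 p1 p2 = biproduct A X Y S p1 p2 i1 i2"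
  by (auto simp: biproduct_def)

lemma opposite_short_exact [simp]: "short_exact (opposite A) X Y Z = short_exact A Z Y X"
  by (auto simp: short_exact_def)

lemma iso_mor_inverse:
  assumes "iso_mor A X Y f"
  obtains g where "iso_mor A Y X g" "cmp A g f = idm A X" "cmp A f g = idm A Y"
  using assms by (auto simp: iso_mor_def)

context exact_category
begin

lemma exact_category_opposite: "exact_category (opposite A)"
proof (intro exact_category.intro additive_category.intro preadditive_category.intro
    precategory.intro preadditive_category_axioms.intro additive_category_axioms.intro
    exact_category_axioms.intro, goal_cases)
  case (1 f) then show ?case by simp
next
  case (2 f) then show ?case by simp
next
  case (3 X) then show ?case using id_hom by simp
next
  case (4 f X Y g Z) then show ?case using cmp_hom by simp
next
  case (5 f X Y) then show ?case using cmp_id_left by simp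
next
  case (6 f X Y) then show ?case using cmp_id_right by simp
next
  case (7 f W X g Y h Z) then show ?case using cmp_assoc[of h Z Y g X f W] by simp
next
  case (8 X Y) then show ?case using hom_group[of Y X] by simp
next
  case (9 f X Y f' g Z) then show ?case using cmp_add_left by simp
next
  case (10 f X Y g Z g') then show ?case using cmp_add_right by simp
next
  case 11 then show ?case using ex_zero_object by simp
next
  case (12 X Y)
  then obtain S i1 i2 p1 p2 where "biproduct A X Y S i1 i2 p1 p2"
    using ex_biproduct[of X Y] by auto
  then show ?case unfolding opposite_biproduct by blast
next
  case (13 i p) then show ?case using ses_cokernel by simp
next
  case (14 i p) then show ?case using ses_kernel by simp
next
  case (15 i p X Y Z i' X' Y' p' Z' a b c)
  \<comment> \<open>The isomorphisms of the ladder point the wrong way in the opposite category; their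
    inverses form the ladder to which closure under isomorphism applies.\<close>
  then have iso: "iso_mor A X' X a" "iso_mor A Y' Y b" "iso_mor A Z' Z c"
    using 15(6-8) by simp_all
  obtain a' where a': "iso_mor A X X' a'" "a' \<cdot> a = idm A X'" "a \<cdot> a' = idm A X"
    using iso(1) by (rule iso_mor_inverse)
  obtain b' where b': "iso_mor A Y Y' b'" "b' \<cdot> b = idm A Y'" "b \<cdot> b' = idm A Y"
    using iso(2) by (rule iso_mor_inverse)
  obtain c' where c': "iso_mor A Z Z' c'" "c' \<cdot> c = idm A Z'" "c \<cdot> c' = idm A Z"
    using iso(3) by (rule iso_mor_inverse)
  have h: "i \<in> homs A Y X" "p \<in> homs A Z Y" "i' \<in> homs A Y' X'" "p' \<in> homs A Z' Y'"
    "a \<in> homs A X' X" "b \<in> homs A Y' Y" "c \<in> homs A Z' Z"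
    "a' \<in> homs A X X'" "b' \<in> homs A Y Y'" "c' \<in> homs A Z Z'"
    using 15(2-5) iso a'(1) b'(1) c'(1) by (simp_all add: iso_mor_def)
  have e: "i \<cdot> b = a \<cdot> i'" "p \<cdot> c = b \<cdot> p'" using 15(9,10) by simp_all
  have "b' \<cdot> p = b' \<cdot> (p \<cdot> (c \<cdot> c'))" using h c'(3) by (auto simp: homs_def)
  also have "\<dots> = b' \<cdot> (b \<cdot> (p' \<cdot> c'))" using h cmp_cong_assoc[OF e(2)] by (auto simp: homs_def)
  also have "\<dots> = p' \<cdot> c'" using h cmp_cong_assoc[OF b'(2)] by (auto simp: homs_def)
  finally have 1: "b' \<cdot> p = p' \<cdot> c'" .
  have "a' \<cdot> i = a' \<cdot> (i \<cdot> (b \<cdot> b'))" using h b'(3) by (auto simp: homs_def)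
  also have "\<dots> = a' \<cdot> (a \<cdot> (i' \<cdot> b'))" using h cmp_cong_assoc[OF e(1)] by (auto simp: homs_def)
  also have "\<dots> = i' \<cdot> b'" using h cmp_cong_assoc[OF a'(2)] by (auto simp: homs_def)
  finally have 2: "a' \<cdot> i = i' \<cdot> b'" .
  have "(p, i) \<in> Ses A" using 15(1) by simp
  then have "(p', i') \<in> Ses A"
    by (rule ses_iso_closed[OF _ h(2) h(1) h(4) h(3) c'(1) b'(1) a'(1) 1 2])
  then show ?case by simp
next
  case (16 X) then show ?case using id_adm_epi by simp
next
  case (17 X) then show ?case using id_adm_mono by simp
next
  case (18 i j) then show ?case using cmp_adm_epi by simp
next
  case (19 p q) then show ?case using cmp_adm_mono by simp
next
  case (20 i f) then show ?case using pullback_adm_epi by simp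
next
  case (21 p f) then show ?case using pushout_adm_mono by simp
qed

section \<open>Kernels, cokernels and pushouts in an exact category\<close>

lemma iso_mor_id: "X \<in> Obj A \<Longrightarrow> iso_mor A X X (idm A X)"
  by (auto simp: iso_mor_def homs_def)

lemma ses_mor:
  assumes "(i, p) \<in> Ses A"
  shows "i \<in> Mor A" "p \<in> Mor A" "Dom A p = Cod A i" "p \<cdot> i = zerom A (Dom A i) (Cod A p)"
  using ses_kernel[OF assms] by (auto simp: is_kernel_def)

lemma ses_factor_kernel:
  assumes "(i, p) \<in> Ses A" "g \<in> Mor A" "Cod A g = Dom A p" "p \<cdot> g = zerom A (Dom A g) (Cod A p)"
  obtains h where "h \<in> Mor A" "Dom A h = Dom A g" "Cod A h = Dom A i" "i \<cdot> h = g"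
  using ses_kernel[OF assms(1)] assms(2-) unfolding is_kernel_def homs_def by blast

lemma ses_factor_cokernel:
  assumes "(i, p) \<in> Ses A" "g \<in> Mor A" "Dom A g = Cod A i" "g \<cdot> i = zerom A (Dom A i) (Cod A g)"
  obtains h where "h \<in> Mor A" "Dom A h = Cod A p" "Cod A h = Cod A g" "h \<cdot> p = g"
  using ses_cokernel[OF assms(1)] assms(2-) unfolding is_cokernel_def homs_def by blast

lemma ses_mono_cancel:
  assumes s: "(i, p) \<in> Ses A" and f: "f \<in> Mor A" "Cod A f = Dom A i"
    and g: "g \<in> Mor A" "Cod A g = Dom A i" "Dom A f = Dom A g" and eq: "i \<cdot> f = i \<cdot> g"
  shows "f = g"
proof -
  note m = ses_mor[OF s]
  have "p \<cdot> (i \<cdot> f) = zerom A (Dom A f) (Cod A p)"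
    using m f cmp_cong_assoc[OF m(4) f(1)] by simp
  moreover have "i \<cdot> f \<in> Mor A" "Dom A (i \<cdot> f) = Dom A f" "Cod A (i \<cdot> f) = Dom A p"
    using m f by auto
  ultimately have "\<exists>!h. h \<in> homs A (Dom A f) (Dom A i) \<and> i \<cdot> h = i \<cdot> f"
    using ses_kernel[OF s] unfolding is_kernel_def by metis
  moreover have "f \<in> homs A (Dom A f) (Dom A i)" "g \<in> homs A (Dom A f) (Dom A i)"
    using f g by (auto simp: homs_def)
  ultimately show ?thesis using eq by metis
qed

lemma ses_epi_cancel:
  assumes s: "(i, p) \<in> Ses A" and f: "f \<in> Mor A" "Dom A f = Cod A p"
    and g: "g \<in> Mor A" "Dom A g = Cod A p" "Cod A f = Cod A g" and eq: "f \<cdot> p = g \<cdot> p"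
  shows "f = g"
  using exact_category.ses_mono_cancel[OF exact_category_opposite, of p i f g] assms by simp

text \<open>
  Cokernels are unique up to a unique isomorphism, and exactness is invariant under isomorphism.
  Exactness of a sequence that starts with an admissible monomorphism can thus be checked by a
  universal property.
\<close>

lemma ses_of_cokernel:
  assumes s: "(i, p) \<in> Ses A" and c: "is_cokernel A i c"
  shows "(i, c) \<in> Ses A"
proof -
  note m = ses_mor[OF s]
  have c': "c \<in> Mor A" "Dom A c = Cod A i" "c \<cdot> i = zerom A (Dom A i) (Cod A c)"
    using c by (auto simp: is_cokernel_def)
  obtain h where h: "h \<in> Mor A" "Dom A h = Cod A p" "Cod A h = Cod A c" "h \<cdot> p = c"
    using ses_factor_cokernel[OF s c'] by blast
  obtain k where k: "k \<in> Mor A" "Dom A k = Cod A c" "Cod A k = Cod A p" "k \<cdot> c = p"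
    using c m unfolding is_cokernel_def homs_def by blast
  have "k \<cdot> h = idm A (Cod A p)"
    by (rule ses_epi_cancel[OF s]) (use m h k in auto)
  moreover have "h \<cdot> k = idm A (Cod A c)"
  proof -
    have "\<exists>!x. x \<in> homs A (Cod A c) (Cod A c) \<and> x \<cdot> c = c"
      using c unfolding is_cokernel_def by blast
    moreover have "h \<cdot> k \<in> homs A (Cod A c) (Cod A c)" "(h \<cdot> k) \<cdot> c = c"
      "idm A (Cod A c) \<in> homs A (Cod A c) (Cod A c)" "idm A (Cod A c) \<cdot> c = c"
      using h k c' by (auto simp: homs_def)
    ultimately show ?thesis by blast
  qed
  ultimately have iso: "iso_mor A (Cod A p) (Cod A c) h"
    using h k by (auto simp: iso_mor_def homs_def)
  show ?thesis
    by (rule ses_iso_closed[OF s _ _ _ _ iso_mor_id iso_mor_id iso, of _ "Cod A i"])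
      (use m h c' in \<open>auto simp: homs_def\<close>)
qed

lemma is_pushout_swap: "is_pushout A i f i' f' \<Longrightarrow> is_pushout A f i f' i'"
  unfolding is_pushout_def by metis

lemma pushout_mor:
  assumes "is_pushout A i f i' f'"
  shows "i \<in> Mor A" "f \<in> Mor A" "i' \<in> Mor A" "f' \<in> Mor A"
    "Dom A i = Dom A f" "Dom A i' = Cod A f" "Dom A f' = Cod A i" "Cod A f' = Cod A i'"
    "i' \<cdot> f = f' \<cdot> i"
  using assms by (auto simp: is_pushout_def)

lemma pushout_factor:
  assumes "is_pushout A i f i' f'" "u \<in> Mor A" "v \<in> Mor A" "Dom A u = Cod A f" "Dom A v = Cod A i"
    "Cod A u = Cod A v" "u \<cdot> f = v \<cdot> i"
  obtains h where "h \<in> Mor A" "Dom A h = Cod A i'" "Cod A h = Cod A u" "h \<cdot> i' = u" "h \<cdot> f' = v"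
  using assms unfolding is_pushout_def homs_def by blast

lemma pushout_cancel:
  assumes "is_pushout A i f i' f'"
    "h \<in> Mor A" "k \<in> Mor A" "Dom A h = Cod A i'" "Dom A k = Cod A i'" "Cod A h = Cod A k"
    "h \<cdot> i' = k \<cdot> i'" "h \<cdot> f' = k \<cdot> f'"
  shows "h = k"
proof -
  note m = pushout_mor[OF assms(1)]
  let ?P = "\<lambda>x. x \<in> homs A (Cod A i') (Cod A (h \<cdot> i')) \<and> x \<cdot> i' = h \<cdot> i' \<and> x \<cdot> f' = h \<cdot> f'"
  have "(h \<cdot> i') \<cdot> f = (h \<cdot> f') \<cdot> i" using m assms by simp
  moreover have "h \<cdot> i' \<in> Mor A" "h \<cdot> f' \<in> Mor A" "Dom A (h \<cdot> i') = Cod A f"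
    "Dom A (h \<cdot> f') = Cod A i" "Cod A (h \<cdot> i') = Cod A (h \<cdot> f')"
    using m assms by auto
  ultimately have "\<exists>!x. ?P x"
    using assms(1) unfolding is_pushout_def by blast
  moreover have "?P h" "?P k" using m assms by (auto simp: homs_def)
  ultimately show ?thesis by blast
qed

text \<open>
  The axiom provides one pushout with the admissible monomorphism opposite to \<open>i\<close>; every other
  pushout is isomorphic to it.  Applied to a square of two admissible monomorphisms and to its
  mirror image, this makes all four sides admissible.
\<close>

lemma adm_mono_of_pushout:
  assumes po: "is_pushout A i f i' f'" and i: "adm_mono A i"
  shows "adm_mono A i'"
proof -
  note m = pushout_mor[OF po]
  obtain j g where po': "is_pushout A i f j g" and "adm_mono A j"
    using pushout_adm_mono[OF i, of f] m by auto
  then obtain q where s: "(j, q) \<in> Ses A" by (auto simp: adm_mono_def)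
  note m' = pushout_mor[OF po'] and ms = ses_mor[OF s]
  obtain h where h: "h \<in> Mor A" "Dom A h = Cod A j" "Cod A h = Cod A i'" "h \<cdot> j = i'" "h \<cdot> g = f'"
    using pushout_factor[OF po', of i' f'] m by auto
  obtain k where k: "k \<in> Mor A" "Dom A k = Cod A i'" "Cod A k = Cod A j" "k \<cdot> i' = j" "k \<cdot> f' = g"
    using pushout_factor[OF po, of j g] m' by auto
  have kh: "k \<cdot> h = idm A (Cod A j)"
    by (rule pushout_cancel[OF po']) (use m m' h k in auto)
  have hk: "h \<cdot> k = idm A (Cod A i')"
    by (rule pushout_cancel[OF po]) (use m m' h k in auto)
  have iso: "iso_mor A (Cod A j) (Cod A i') h"
    using h k hk kh by (auto simp: iso_mor_def homs_def)
  \<comment> \<open>\<open>q\<close> is the cokernel of \<open>j\<close>, and \<open>k\<close> identifies the two pushout objects.\<close>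
  have "(i', q \<cdot> k) \<in> Ses A"
    by (rule ses_iso_closed[OF s _ _ _ _ iso_mor_id iso iso_mor_id, of "Cod A f" "Cod A q"])
      (use m m' ms h k kh in \<open>auto simp: homs_def\<close>)
  then show ?thesis by (auto simp: adm_mono_def)
qed

text \<open>
  Pushing out does not change the cokernel: a morphism that vanishes on \<open>i'\<close> is, by the universal
  property of the square, the same as a morphism out of the codomain of \<open>i\<close> that vanishes on \<open>i\<close>.
\<close>

lemma ses_pushout:
  assumes po: "is_pushout A i f i' f'" and s: "(i, p) \<in> Ses A"
  obtains p' where "(i', p') \<in> Ses A" "p' \<cdot> f' = p" "Cod A p' = Cod A p"
proof -
  note m = pushout_mor[OF po] and ms = ses_mor[OF s]
  obtain q where q: "(i', q) \<in> Ses A"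
    using adm_mono_of_pushout[OF po] s unfolding adm_mono_def by blast
  obtain p' where p': "p' \<in> Mor A" "Dom A p' = Cod A i'" "Cod A p' = Cod A p"
    "p' \<cdot> i' = zerom A (Cod A f) (Cod A p)" "p' \<cdot> f' = p"
    using pushout_factor[OF po, of "zerom A (Cod A f) (Cod A p)" p] m ms by auto
  have "is_cokernel A i' p'"
    unfolding is_cokernel_def
  proof (intro conjI ballI impI)
    fix g assume g: "g \<in> Mor A"
      and "Dom A g = Cod A i' \<and> g \<cdot> i' = zerom A (Dom A i') (Cod A g)"
    then have g': "Dom A g = Cod A i'" "g \<cdot> i' = zerom A (Dom A i') (Cod A g)" by auto
    have "(g \<cdot> f') \<cdot> i = (g \<cdot> i') \<cdot> f" using m g g'(1) by simp
    also have "\<dots> = zerom A (Dom A i) (Cod A g)" using m g g'(2) by simp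
    finally obtain h where h: "h \<in> Mor A" "Dom A h = Cod A p" "Cod A h = Cod A g"
      "h \<cdot> p = g \<cdot> f'"
      using ses_factor_cokernel[OF s, of "g \<cdot> f'"] m g g' by auto
    have "h \<cdot> p' = g"
      by (rule pushout_cancel[OF po]) (use m ms g g' h p' in auto)
    moreover have "x = h" if "x \<in> homs A (Cod A p') (Cod A g)" "x \<cdot> p' = g" for x
    proof (rule ses_epi_cancel[OF s])
      show "x \<cdot> p = h \<cdot> p"
        using cmp_cong_assoc[OF that(2), of f'] that(1) m p' h by (auto simp: homs_def)
    qed (use that p' h in \<open>auto simp: homs_def\<close>)
    moreover have "h \<in> homs A (Cod A p') (Cod A g)"
      using h p' by (simp add: homs_def)
    ultimately show "\<exists>!h. h \<in> homs A (Cod A p') (Cod A g) \<and> h \<cdot> p' = g"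
      by blast
  qed (use m p' in auto)
  then show ?thesis using that[OF ses_of_cokernel[OF q]] p' by auto
qed

lemma ses_pushout_along:
  assumes s: "(i, p) \<in> Ses A" and f: "f \<in> Mor A" "Dom A f = Dom A i"
  obtains i' p' f' where "is_pushout A i f i' f'" "(i', p') \<in> Ses A" "p' \<cdot> f' = p"
    "Cod A p' = Cod A p"
proof -
  obtain i' f' where po: "is_pushout A i f i' f'"
    using pushout_adm_mono[OF _ f] s by (auto simp: adm_mono_def)
  show ?thesis by (rule ses_pushout[OF po s]) (rule that[OF po])
qed

text \<open>
  The Noether isomorphism \<open>(U/X)/(Y/X) = U/Y\<close> for \<open>X \<rightarrow> Y \<rightarrow> U\<close>, given by \<open>i\<close> and \<open>j\<close>.  In the pushout of
  \<open>j\<close> along the projection \<open>Y \<rightarrow> Y/X\<close>, the leg out of \<open>U\<close> is the cokernel of \<open>j \<cdot> i\<close>; and pushing the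
  short exact sequence \<open>(j, q)\<close> out keeps its third term \<open>U/Y\<close>.
\<close>

lemma ses_composite_mono:
  assumes s: "(i, p) \<in> Ses A" and t: "(j, q) \<in> Ses A" and ij: "Cod A i = Dom A j"
  obtains r k l where "(j \<cdot> i, r) \<in> Ses A" "(k, l) \<in> Ses A" "Dom A k = Cod A p"
    "Cod A k = Cod A r" "l \<cdot> r = q" "Cod A l = Cod A q"
proof -
  note ms = ses_mor[OF s] and mt = ses_mor[OF t]
  obtain k l r where po: "is_pushout A j p k r" and kl: "(k, l) \<in> Ses A" "l \<cdot> r = q"
    "Cod A l = Cod A q"
    by (rule ses_pushout_along[OF t, of p]) (use ms ij in auto)
  note m = pushout_mor(1-4,6-8)[OF po] and sq = pushout_mor(9)[OF po]
  obtain r' where r': "(j \<cdot> i, r') \<in> Ses A"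
    using cmp_adm_mono[of i j] s t ij by (auto simp: adm_mono_def)
  have "is_cokernel A (j \<cdot> i) r"
    unfolding is_cokernel_def
  proof (intro conjI ballI impI)
    have "r \<cdot> (j \<cdot> i) = k \<cdot> (p \<cdot> i)"
      using cmp_cong_assoc[OF sq[symmetric], of i] ms mt m ij by simp
    then show "r \<cdot> (j \<cdot> i) = zerom A (Dom A (j \<cdot> i)) (Cod A r)"
      using ms mt m ij by simp
    fix g assume g: "g \<in> Mor A"
      and "Dom A g = Cod A (j \<cdot> i) \<and> g \<cdot> (j \<cdot> i) = zerom A (Dom A (j \<cdot> i)) (Cod A g)"
    then have g': "Dom A g = Cod A j" "g \<cdot> (j \<cdot> i) = zerom A (Dom A i) (Cod A g)"
      using ms mt ij by auto
    obtain u where u: "u \<in> Mor A" "Dom A u = Cod A p" "Cod A u = Cod A g" "u \<cdot> p = g \<cdot> j"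
      using ses_factor_cokernel[OF s, of "g \<cdot> j"] g g' ms mt ij by auto
    obtain h where h: "h \<in> Mor A" "Dom A h = Cod A k" "Cod A h = Cod A u" "h \<cdot> k = u" "h \<cdot> r = g"
      using pushout_factor[OF po, of u g] u g g' by auto
    have "x = h" if x: "x \<in> homs A (Cod A r) (Cod A g)" "x \<cdot> r = g" for x
    proof (rule pushout_cancel[OF po])
      show "x \<cdot> k = h \<cdot> k"
      proof (rule ses_epi_cancel[OF s])
        have "(x \<cdot> k) \<cdot> p = (x \<cdot> r) \<cdot> j" using x(1) m ms mt ij sq by (simp add: homs_def)
        also have "\<dots> = (h \<cdot> k) \<cdot> p" using x(2) h u m ms by simp
        finally show "(x \<cdot> k) \<cdot> p = (h \<cdot> k) \<cdot> p" .
      qed (use x m h u ms mt in \<open>auto simp: homs_def\<close>)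
    qed (use x m h u ms mt in \<open>auto simp: homs_def\<close>)
    moreover have "h \<in> homs A (Cod A r) (Cod A g)"
      using h u m by (simp add: homs_def)
    ultimately show "\<exists>!h. h \<in> homs A (Cod A r) (Cod A g) \<and> h \<cdot> r = g"
      using h(5) by blast
  qed (use ms mt m ij in auto)
  from that[OF ses_of_cokernel[OF r' this] kl(1) _ _ kl(2,3)] m show ?thesis by simp
qed

lemma ses_pullback_along:
  assumes s: "(i, p) \<in> Ses A" and f: "f \<in> Mor A" "Cod A f = Cod A p"
  obtains i' p' f' where "is_pullback A p f p' f'" "(i', p') \<in> Ses A" "f' \<cdot> i' = i"
    "Dom A i' = Dom A i"
  by (rule exact_category.ses_pushout_along[OF exact_category_opposite, of p i f])
    (use assms that in auto)

lemma short_exact_composite_mono: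
  assumes "short_exact A X Y Z" "short_exact A Y U V"
  obtains W where "short_exact A X U W" "short_exact A Z W V"
proof -
  obtain i p where ip: "i \<in> homs A X Y" "p \<in> homs A Y Z" "(i, p) \<in> Ses A"
    using assms(1) by (auto simp: short_exact_def)
  obtain j q where jq: "j \<in> homs A Y U" "q \<in> homs A U V" "(j, q) \<in> Ses A"
    using assms(2) by (auto simp: short_exact_def)
  obtain r k l where *: "(j \<cdot> i, r) \<in> Ses A" "(k, l) \<in> Ses A" "Dom A k = Cod A p"
    "Cod A k = Cod A r" "l \<cdot> r = q" "Cod A l = Cod A q"
    by (rule ses_composite_mono[OF ip(3) jq(3)]) (use ip jq in \<open>auto simp: homs_def\<close>)
  have "short_exact A X U (Cod A r)"
    unfolding short_exact_def
    by (intro bexI[of _ "j \<cdot> i"] bexI[of _ r])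
      (use *(1) ses_mor[OF *(1)] ip jq in \<open>auto simp: homs_def\<close>)
  moreover have "short_exact A Z (Cod A r) V"
    unfolding short_exact_def
    by (intro bexI[of _ k] bexI[of _ l])
      (use * ses_mor[OF *(2)] ip jq in \<open>auto simp: homs_def\<close>)
  ultimately show ?thesis by (rule that)
qed

lemma short_exact_composite_epi:
  assumes "short_exact A X Y Z" "short_exact A V Z U"
  obtains W where "short_exact A W Y U" "short_exact A X W V"
  by (rule exact_category.short_exact_composite_mono[OF exact_category_opposite, of U Z V Y X])
    (use assms that in auto)

text \<open>
  A pushout square of two admissible monomorphisms, read in both directions, is a pushout of either
  short exact sequence along the other.
\<close>

lemma short_exact_pushout:
  assumes "short_exact A X Y Z" "short_exact A X R Q"
  obtains P where "short_exact A R P Z" "short_exact A Y P Q"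
proof -
  obtain i p where ip: "i \<in> homs A X Y" "p \<in> homs A Y Z" "(i, p) \<in> Ses A"
    using assms(1) by (auto simp: short_exact_def)
  obtain j q where jq: "j \<in> homs A X R" "q \<in> homs A R Q" "(j, q) \<in> Ses A"
    using assms(2) by (auto simp: short_exact_def)
  obtain i' p' j' where *: "is_pushout A i j i' j'" "(i', p') \<in> Ses A" "Cod A p' = Cod A p"
    by (rule ses_pushout_along[OF ip(3), of j]) (use ip jq in \<open>auto simp: homs_def\<close>)
  obtain q' where q': "(j', q') \<in> Ses A" "Cod A q' = Cod A q"
    by (rule ses_pushout[OF is_pushout_swap[OF *(1)] jq(3)])
  note m = pushout_mor[OF *(1)]
  have "short_exact A R (Cod A i') Z"
    unfolding short_exact_def
    by (intro bexI[of _ i'] bexI[of _ p'])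
      (use * m(6) ses_mor[OF *(2)] ip jq in \<open>auto simp: homs_def\<close>)
  moreover have "short_exact A Y (Cod A i') Q"
    unfolding short_exact_def
    by (intro bexI[of _ j'] bexI[of _ q'])
      (use q' m(7,8) ses_mor[OF q'(1)] ip jq in \<open>auto simp: homs_def\<close>)
  ultimately show ?thesis by (rule that)
qed

lemma short_exact_pullback:
  assumes "short_exact A X Y Z" "short_exact A R Q Z"
  obtains P where "short_exact A X P Q" "short_exact A R P Y"
  by (rule exact_category.short_exact_pushout[OF exact_category_opposite, of Z Y X Q R])
    (use assms that in auto)

lemma short_exact_obj:
  assumes "short_exact A X Y Z"
  shows "X \<in> Obj A" "Y \<in> Obj A" "Z \<in> Obj A"
  using assms by (auto simp: short_exact_def homs_def)

text \<open>
  Pushing \<open>X \<rightarrow> R\<close> out along the inclusion of a retract exhibits \<open>R\<close> as a retract of the pushout: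
  the retraction is induced by the identity of \<open>R\<close> and by \<open>Y \<rightarrow> X \<rightarrow> R\<close>.
\<close>

lemma short_exact_pushout_retract:
  assumes "is_retract A X Y" "short_exact A X R Q"
  obtains P where "short_exact A Y P Q" "is_retract A R P"
proof -
  obtain s r where sr: "s \<in> homs A X Y" "r \<in> homs A Y X" "r \<cdot> s = idm A X"
    using assms(1) by (auto simp: is_retract_def)
  obtain j q where jq: "j \<in> homs A X R" "q \<in> homs A R Q" "(j, q) \<in> Ses A"
    using assms(2) by (auto simp: short_exact_def)
  obtain j' q' s' where *: "is_pushout A j s j' s'" "(j', q') \<in> Ses A" "Cod A q' = Cod A q"
    by (rule ses_pushout_along[OF jq(3), of s]) (use sr jq in \<open>auto simp: homs_def\<close>)
  note m = pushout_mor[OF *(1)]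
  have "(j \<cdot> r) \<cdot> s = idm A R \<cdot> j" using sr jq by (auto simp: homs_def)
  then obtain h where h: "h \<in> Mor A" "Dom A h = Cod A j'" "Cod A h = R" "h \<cdot> s' = idm A R"
    by (rule_tac pushout_factor[OF *(1), of "j \<cdot> r" "idm A R"])
      (use sr jq in \<open>auto simp: homs_def\<close>)
  have "is_retract A R (Cod A j')"
    unfolding is_retract_def
    by (intro bexI[of _ s'] bexI[of _ h]) (use h m(4,7,8) jq in \<open>auto simp: homs_def\<close>)
  moreover have "short_exact A Y (Cod A j') Q"
    unfolding short_exact_def
    by (intro bexI[of _ j'] bexI[of _ q'])
      (use * m(6) ses_mor[OF *(2)] jq sr in \<open>auto simp: homs_def\<close>)
  ultimately show ?thesis using that by blast
qed

section \<open>Vanishing of Ext and splitting\<close>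

lemma biproduct_comparison:
  assumes "biproduct A X Y S i s r p" "biproduct A X Y S' i' s' r' p'"
  obtains b where "b \<in> homs A S S'" "b \<cdot> i = i'" "b \<cdot> s = s'" "p' \<cdot> b = p"
proof -
  have 1: "i \<in> Mor A" "Dom A i = X" "Cod A i = S" "s \<in> Mor A" "Dom A s = Y" "Cod A s = S"
    "r \<in> Mor A" "Dom A r = S" "Cod A r = X" "p \<in> Mor A" "Dom A p = S" "Cod A p = Y"
    "r \<cdot> i = idm A X" "p \<cdot> s = idm A Y" "r \<cdot> s = zerom A Y X" "p \<cdot> i = zerom A X Y"
    using assms(1) by (auto simp: biproduct_def homs_def)
  have 2: "i' \<in> Mor A" "Dom A i' = X" "Cod A i' = S'" "s' \<in> Mor A" "Dom A s' = Y" "Cod A s' = S'"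
    "p' \<in> Mor A" "Dom A p' = S'" "Cod A p' = Y" "p' \<cdot> s' = idm A Y" "p' \<cdot> i' = zerom A X Y"
    using assms(2) by (auto simp: biproduct_def homs_def)
  have obj: "X \<in> Obj A" "Y \<in> Obj A" using 1 dom_obj by blast+
  show ?thesis
  proof (rule that)
    show "addm A (i' \<cdot> r) (s' \<cdot> p) \<in> homs A S S'" using 1 2 by (simp add: homs_def)
    show "addm A (i' \<cdot> r) (s' \<cdot> p) \<cdot> i = i'" using 1 2 obj by simp
    show "addm A (i' \<cdot> r) (s' \<cdot> p) \<cdot> s = s'" using 1 2 obj by simp
    show "p' \<cdot> addm A (i' \<cdot> r) (s' \<cdot> p) = p"
      using 1 2 obj cmp_cong_assoc[OF 2(10), of p] cmp_cong_assoc[OF 2(11), of r] by simp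
  qed
qed

lemma biproduct_endo_id:
  assumes bi: "biproduct A X Y S i s r p" and f: "f \<in> homs A S S" "f \<cdot> i = i" "f \<cdot> s = s"
  shows "f = idm A S"
proof -
  have 1: "i \<in> Mor A" "Dom A i = X" "Cod A i = S" "s \<in> Mor A" "Dom A s = Y" "Cod A s = S"
    "r \<in> Mor A" "Dom A r = S" "Cod A r = X" "p \<in> Mor A" "Dom A p = S" "Cod A p = Y"
    "addm A (i \<cdot> r) (s \<cdot> p) = idm A S"
    using bi by (auto simp: biproduct_def homs_def)
  have f': "f \<in> Mor A" "Dom A f = S" "Cod A f = S" using f by (auto simp: homs_def)
  have "f = f \<cdot> addm A (i \<cdot> r) (s \<cdot> p)" using 1(13) f' by simp
  also have "\<dots> = addm A (i \<cdot> r) (s \<cdot> p)"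
    using 1(1-12) f' cmp_cong_assoc[OF f(2), of r] cmp_cong_assoc[OF f(3), of p] by simp
  finally show ?thesis using 1(13) by simp
qed

text \<open>
  The endomorphism \<open>id - s \<cdot> p\<close> is killed by \<open>p\<close>, so it factors through the kernel \<open>i\<close>; the factor is
  the retraction \<open>r\<close>.
\<close>

lemma ses_section_biproduct:
  assumes ses: "(i, p) \<in> Ses A"
    and s: "s \<in> Mor A" "Dom A s = Cod A p" "Cod A s = Cod A i" "p \<cdot> s = idm A (Cod A p)"
  obtains r where "biproduct A (Dom A i) (Cod A p) (Cod A i) i s r p"
proof -
  note m = ses_mor[OF ses]
  let ?B = "Cod A i"
  \<comment> \<open>\<open>d\<close> is \<open>id - s \<cdot> p\<close>.\<close>
  obtain d where d: "d \<in> Mor A" "Dom A d = ?B" "Cod A d = ?B" "addm A d (s \<cdot> p) = idm A ?B"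
    using add_solve[of ?B ?B "s \<cdot> p" "idm A ?B"] m s by (auto simp: homs_def)
  have "addm A (p \<cdot> d) p = p \<cdot> addm A d (s \<cdot> p)"
    using m s d(1-3) cmp_cong_assoc[OF s(4), of p] by simp
  also have "\<dots> = p" using m d by simp
  finally have "p \<cdot> d = zerom A ?B (Cod A p)"
    using add_eq_right[of ?B "Cod A p" "p \<cdot> d" p] m d by (simp add: homs_def)
  then obtain r where r: "r \<in> Mor A" "Dom A r = ?B" "Cod A r = Dom A i" "i \<cdot> r = d"
    using ses_factor_kernel[OF ses, of d] m d by metis
  have sum: "addm A (i \<cdot> r) (s \<cdot> p) = idm A ?B" using r d by simp
  have "i = addm A (i \<cdot> r) (s \<cdot> p) \<cdot> i" using sum m by simp
  also have "\<dots> = addm A (i \<cdot> (r \<cdot> i)) (s \<cdot> (p \<cdot> i))" using m r(1-3) s(1-3) by simp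
  also have "\<dots> = i \<cdot> (r \<cdot> i)" using m r(1-3) s(1-3) by simp
  finally have "i \<cdot> (r \<cdot> i) = i \<cdot> idm A (Dom A i)" using m by simp
  note ses_mono_cancel[OF ses _ _ _ _ _ this]
  then have ri: "r \<cdot> i = idm A (Dom A i)"
    using m r(1-3) by simp
  have "s = addm A (i \<cdot> r) (s \<cdot> p) \<cdot> s" using sum s by simp
  also have "\<dots> = addm A (i \<cdot> (r \<cdot> s)) (s \<cdot> (p \<cdot> s))" using m r(1-3) s(1-3) by simp
  also have "\<dots> = addm A (i \<cdot> (r \<cdot> s)) s" using m s by simp
  finally have "i \<cdot> (r \<cdot> s) = zerom A (Cod A p) ?B"
    using add_eq_right[of "Cod A p" ?B "i \<cdot> (r \<cdot> s)" s] m r(1-3) s by (simp add: homs_def)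
  then have "i \<cdot> (r \<cdot> s) = i \<cdot> zerom A (Cod A p) (Dom A i)" using m by simp
  note ses_mono_cancel[OF ses _ _ _ _ _ this]
  then have rs: "r \<cdot> s = zerom A (Cod A p) (Dom A i)"
    using m r(1-3) s(1-3) by simp
  show ?thesis
    by (rule that, unfold biproduct_def) (use sum ri rs m r(1-3) s in \<open>auto simp: homs_def\<close>)
qed

text \<open>
  \<open>Ext1_vanishes\<close> asserts an equality of sets of classes, so it also claims that there is an extension
  at all.  One is obtained by pushing out the kernel \<open>K\<close> of the identity of \<open>C\<close> along the zero map
  \<open>K \<rightarrow> F\<close>.
\<close>

lemma extension_exists:
  assumes C: "C \<in> Obj A" and F: "F \<in> Obj A"
  shows "extensions A C F \<noteq> {}"
proof -
  obtain k where k: "(k, idm A C) \<in> Ses A" using id_adm_epi[OF C] by (auto simp: adm_epi_def)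
  obtain i p where "(i, p) \<in> Ses A" "Dom A i = F" "Cod A p = C"
  proof (rule ses_pushout_along[OF k, of "zerom A (Dom A k) F"])
    fix i' p' f'
    assume "is_pushout A k (zerom A (Dom A k) F) i' f'" "(i', p') \<in> Ses A"
      "Cod A p' = Cod A (idm A C)"
    then show thesis
      using that pushout_mor[of k "zerom A (Dom A k) F" i' f'] ses_mor[OF k] C F by auto
  qed (use ses_mor[OF k] F in auto)
  then show ?thesis by (auto simp: extensions_def)
qed

text \<open>
  An extension with a section is a biproduct, and any two biproducts of \<open>F\<close> and \<open>C\<close> are equivalent
  extensions.  So if all extensions have sections, there is only one class; conversely, a section
  travels along an equivalence with a biproduct.
\<close>

lemma Ext1_vanishes_iff_section:
  assumes C: "C \<in> Obj A" and F: "F \<in> Obj A"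
  shows "Ext1_vanishes A C F \<longleftrightarrow>
    (\<forall>i p. (i, p) \<in> Ses A \<longrightarrow> Dom A i = F \<longrightarrow> Cod A p = C \<longrightarrow>
       (\<exists>s \<in> homs A C (Dom A p). p \<cdot> s = idm A C))" (is "_ \<longleftrightarrow> ?split")
proof
  assume van: "Ext1_vanishes A C F"
  show ?split
  proof (intro allI impI)
    fix i p assume ses: "(i, p) \<in> Ses A" and FC: "Dom A i = F" "Cod A p = C"
    note m = ses_mor[OF ses]
    have ext: "(i, p) \<in> extensions A C F" using ses FC by (simp add: extensions_def)
    have "((i, p), (i, p)) \<in> ext_equiv A C F"
      using m ext iso_mor_id[of "Cod A i"] by (auto simp: ext_equiv_def)
    moreover have "ext_equiv A C F `` {(i, p)} = Ext1_zero A C F"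
      using van ext quotientI[of "(i, p)" "extensions A C F" "ext_equiv A C F"]
      unfolding Ext1_vanishes_def Ext1_def by auto
    ultimately have "(i, p) \<in> Ext1_zero A C F" by blast
    then obtain S i1 i2 p1 p2 b where bi: "biproduct A F C S i1 i2 p1 p2"
      and b: "iso_mor A (Cod A i1) (Cod A i) b" "p \<cdot> b = p2"
      by (auto simp: Ext1_zero_def ext_equiv_def)
    have "p \<cdot> (b \<cdot> i2) = p2 \<cdot> i2"
      using b m bi cmp_cong_assoc[OF b(2), of i2]
      by (auto simp: iso_mor_def biproduct_def homs_def)
    then show "\<exists>s \<in> homs A C (Dom A p). p \<cdot> s = idm A C"
      using b bi m by (intro bexI[of _ "b \<cdot> i2"]) (auto simp: iso_mor_def biproduct_def homs_def)
  qed
next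
  assume split: ?split
  let ?E = "extensions A C F"
  have bi: "\<exists>s r. biproduct A F C (Cod A i) i s r p" if "(i, p) \<in> ?E" for i p
  proof -
    have ses: "(i, p) \<in> Ses A" "Dom A i = F" "Cod A p = C"
      using that by (auto simp: extensions_def)
    then obtain s where "s \<in> homs A C (Dom A p)" "p \<cdot> s = idm A C" using split by blast
    then obtain r where "biproduct A (Dom A i) (Cod A p) (Cod A i) i s r p"
      by (rule_tac ses_section_biproduct[OF ses(1), of s])
        (use ses ses_mor[OF ses(1)] in \<open>auto simp: homs_def\<close>)
    then show ?thesis using ses by blast
  qed
  have equiv: "((i, p), (i', p')) \<in> ext_equiv A C F" if e: "(i, p) \<in> ?E" and e': "(i', p') \<in> ?E"
    for i p i' p'
  proof -
    obtain s r where bi1: "biproduct A F C (Cod A i) i s r p" using bi[OF e] by blast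
    obtain s' r' where bi2: "biproduct A F C (Cod A i') i' s' r' p'" using bi[OF e'] by blast
    obtain b where b: "b \<in> homs A (Cod A i) (Cod A i')" "b \<cdot> i = i'" "b \<cdot> s = s'" "p' \<cdot> b = p"
      by (rule biproduct_comparison[OF bi1 bi2])
    obtain c where c: "c \<in> homs A (Cod A i') (Cod A i)" "c \<cdot> i' = i" "c \<cdot> s' = s"
      by (rule biproduct_comparison[OF bi2 bi1])
    note m = bi1[unfolded biproduct_def homs_def, simplified]
      bi2[unfolded biproduct_def homs_def, simplified]
    have "c \<cdot> b = idm A (Cod A i)"
      by (rule biproduct_endo_id[OF bi1]) (use b c m in \<open>auto simp: homs_def\<close>)
    moreover have "b \<cdot> c = idm A (Cod A i')"
      by (rule biproduct_endo_id[OF bi2]) (use b c m in \<open>auto simp: homs_def\<close>)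
    ultimately show ?thesis
      using e e' b c unfolding ext_equiv_def iso_mor_def by auto
  qed
  have "Ext1_zero A C F = ?E"
  proof
    show "Ext1_zero A C F \<subseteq> ?E" by (auto simp: Ext1_zero_def ext_equiv_def)
    show "?E \<subseteq> Ext1_zero A C F" using bi equiv by (fastforce simp: Ext1_zero_def)
  qed
  moreover have "ext_equiv A C F = ?E \<times> ?E"
    using equiv by (auto simp: ext_equiv_def)
  ultimately show "Ext1_vanishes A C F"
    using extension_exists[OF C F] unfolding Ext1_vanishes_def Ext1_def quotient_def by auto
qed

text \<open>
  In the opposite category a section of \<open>p\<close> turns into a retraction of \<open>i\<close>, and a split sequence has
  both.
\<close>

lemma Ext1_vanishes_opposite_imp:
  assumes C: "C \<in> Obj A" and F: "F \<in> Obj A" and van: "Ext1_vanishes A C F"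
  shows "Ext1_vanishes (opposite A) F C"
  unfolding exact_category.Ext1_vanishes_iff_section[OF exact_category_opposite, of F C,
      simplified, OF F C]
proof (intro allI impI)
  fix p i assume ses: "(i, p) \<in> Ses A" and FC: "Cod A p = C" "Dom A i = F"
  obtain s where "s \<in> homs A C (Dom A p)" "p \<cdot> s = idm A C"
    using van ses FC unfolding Ext1_vanishes_iff_section[OF C F] by blast
  then obtain r where "biproduct A F C (Cod A i) i s r p"
    by (rule_tac ses_section_biproduct[OF ses, of s])
      (use ses ses_mor[OF ses] FC in \<open>auto simp: homs_def\<close>)
  then show "\<exists>s \<in> homs A (Cod A i) F. s \<cdot> i = idm A F"
    by (auto simp: biproduct_def)
qed

lemma Ext1_vanishes_opposite:
  assumes "C \<in> Obj A" "F \<in> Obj A"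
  shows "Ext1_vanishes (opposite A) F C \<longleftrightarrow> Ext1_vanishes A C F"
  using Ext1_vanishes_opposite_imp[of C F] assms
    exact_category.Ext1_vanishes_opposite_imp[OF exact_category_opposite, of F C]
  by auto

text \<open>
  A section of the pullback of \<open>(i, p)\<close> along \<open>f\<close> is the same as a lift of \<open>f\<close> through \<open>p\<close>.
\<close>

lemma Ext1_vanishes_lift:
  assumes ses: "(i, p) \<in> Ses A" and van: "Ext1_vanishes A C (Dom A i)"
    and f: "f \<in> homs A C (Cod A p)"
  obtains g where "g \<in> homs A C (Dom A p)" "p \<cdot> g = f"
proof -
  have f': "f \<in> Mor A" "Dom A f = C" "Cod A f = Cod A p" using f by (auto simp: homs_def)
  have obj: "C \<in> Obj A" "Dom A i \<in> Obj A" using f' ses_mor[OF ses] by auto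
  obtain i' p' f'' where *: "is_pullback A p f p' f''" "(i', p') \<in> Ses A" "Dom A i' = Dom A i"
    by (rule ses_pullback_along[OF ses f'(1,3)])
  have m: "p \<in> Mor A" "p' \<in> Mor A" "f'' \<in> Mor A" "Cod A p' = C" "Cod A f'' = Dom A p"
    "Dom A f'' = Dom A p'" "f \<cdot> p' = p \<cdot> f''"
    using *(1) f' by (auto simp: is_pullback_def)
  obtain s where s: "s \<in> homs A C (Dom A p')" "p' \<cdot> s = idm A C"
    using van *(2,3) m(4) unfolding Ext1_vanishes_iff_section[OF obj] by blast
  show ?thesis
  proof (rule that)
    show "f'' \<cdot> s \<in> homs A C (Dom A p)" using s m by (auto simp: homs_def)
    show "p \<cdot> (f'' \<cdot> s) = f"
      using cmp_cong_assoc[OF m(7)[symmetric], of s] s m(1-6) f' by (auto simp: homs_def)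
  qed
qed

lemma Ext1_vanishes_extend:
  assumes ses: "(i, p) \<in> Ses A" and van: "Ext1_vanishes A (Cod A p) F"
    and f: "f \<in> homs A (Dom A i) F"
  obtains g where "g \<in> homs A (Cod A i) F" "g \<cdot> i = f"
proof -
  have "Cod A p \<in> Obj A" "F \<in> Obj A" using ses_mor[OF ses] f by (auto simp: homs_def)
  then have "Ext1_vanishes (opposite A) F (Cod A p)" using van Ext1_vanishes_opposite by simp
  then show ?thesis
    by (rule_tac exact_category.Ext1_vanishes_lift[OF exact_category_opposite, of p i F f])
      (use ses f that in auto)
qed

text \<open>
  Given \<open>F \<rightarrow> B \<rightarrow> C\<close>, the inclusion \<open>F \<rightarrow> F'\<close> extends to \<open>B \<rightarrow> F'\<close>; composed with \<open>F' \<rightarrow> F\<close> it is a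
  retraction of \<open>F \<rightarrow> B\<close>.
\<close>

lemma Ext1_vanishes_retract:
  assumes C: "C \<in> Obj A" and ret: "is_retract A F F'" and van: "Ext1_vanishes A C F'"
  shows "Ext1_vanishes A C F"
proof -
  obtain s r where sr: "s \<in> homs A F F'" "r \<in> homs A F' F" "r \<cdot> s = idm A F"
    using ret by (auto simp: is_retract_def)
  then have F: "F \<in> Obj A" by (auto simp: homs_def)
  \<comment> \<open>In the opposite category the condition reads: every extension has a retraction.\<close>
  have "Ext1_vanishes (opposite A) F C"
    unfolding exact_category.Ext1_vanishes_iff_section[OF exact_category_opposite, of F C,
        simplified, OF F C]
  proof (intro allI impI)
    fix p i assume ses: "(i, p) \<in> Ses A" and FC: "Cod A p = C" "Dom A i = F"
    obtain g where g: "g \<in> homs A (Cod A i) F'" "g \<cdot> i = s"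
      by (rule Ext1_vanishes_extend[OF ses, of F' s]) (use van FC sr in auto)
    have "(r \<cdot> g) \<cdot> i = idm A F" using g sr ses_mor[OF ses] by (auto simp: homs_def)
    moreover have "r \<cdot> g \<in> homs A (Cod A i) F" using g sr by (auto simp: homs_def)
    ultimately show "\<exists>s \<in> homs A (Cod A i) F. s \<cdot> i = idm A F" by blast
  qed
  then show ?thesis using Ext1_vanishes_opposite[OF C F] by simp
qed

text \<open>
  Given \<open>Y \<rightarrow> B \<rightarrow> C\<close>, divide by \<open>X\<close>: the sequence \<open>Z \<rightarrow> B/X \<rightarrow> C\<close> of the Noether isomorphism has a
  section, and this section lifts through \<open>B \<rightarrow> B/X\<close>, whose kernel is \<open>X\<close>.
\<close>

lemma Ext1_vanishes_extension_right:
  assumes C: "C \<in> Obj A" and se: "short_exact A X Y Z"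
    and X: "Ext1_vanishes A C X" and Z: "Ext1_vanishes A C Z"
  shows "Ext1_vanishes A C Y"
  unfolding Ext1_vanishes_iff_section[OF C short_exact_obj(2)[OF se]]
proof (intro allI impI)
  fix j q assume jq: "(j, q) \<in> Ses A" "Dom A j = Y" "Cod A q = C"
  note obj = short_exact_obj[OF se]
  obtain i p where ip: "i \<in> homs A X Y" "p \<in> homs A Y Z" "(i, p) \<in> Ses A"
    using se by (auto simp: short_exact_def)
  then have i: "Cod A i = Y" "Dom A i = X" "i \<in> Mor A" "Cod A p = Z" by (auto simp: homs_def)
  obtain r k l where *: "(j \<cdot> i, r) \<in> Ses A" "(k, l) \<in> Ses A" "Dom A k = Cod A p"
    "Cod A k = Cod A r" "l \<cdot> r = q" "Cod A l = Cod A q"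
    by (rule ses_composite_mono[OF ip(3) jq(1)]) (use ip jq in \<open>auto simp: homs_def\<close>)
  have "Dom A k = Z" "Cod A l = C" using * jq i by auto
  then obtain t where t: "t \<in> homs A C (Dom A l)" "l \<cdot> t = idm A C"
    using Z *(2) unfolding Ext1_vanishes_iff_section[OF C obj(3)] by blast
  have "Dom A (j \<cdot> i) = X" using i jq ses_mor[OF jq(1)] by auto
  moreover have t': "t \<in> homs A C (Cod A r)"
    using t *(4) ses_mor[OF *(2)] by (auto simp: homs_def)
  ultimately obtain g where g: "g \<in> homs A C (Dom A r)" "r \<cdot> g = t"
    by (rule_tac Ext1_vanishes_lift[OF *(1), of C t]) (use X in auto)
  have rd: "Dom A r = Dom A q"
    using ses_mor[OF *(1)] ses_mor[OF jq(1)] i jq by auto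
  have "q \<cdot> g = l \<cdot> (r \<cdot> g)"
    using *(4,5) ses_mor[OF *(1)] ses_mor[OF *(2)] g(1) by (auto simp: homs_def)
  also have "\<dots> = idm A C" using g t by simp
  finally show "\<exists>s \<in> homs A C (Dom A q). q \<cdot> s = idm A C" using g rd by auto
qed

end

section \<open>Cotorsion pairs\<close>

lemma cotorsion_pair_right_unique:
  assumes "cotorsion_pair A \<C> \<F>" "cotorsion_pair A \<C> \<F>'"
  shows "\<F> = \<F>'"
proof -
  have "\<F> = {F \<in> Obj A. \<forall>C \<in> \<C>. Ext1_vanishes A C F}"
    using assms(1) unfolding cotorsion_pair_def by (elim conjE)
  moreover have "\<F>' = {F \<in> Obj A. \<forall>C \<in> \<C>. Ext1_vanishes A C F}"
    using assms(2) unfolding cotorsion_pair_def by (elim conjE)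
  ultimately show ?thesis by (rule trans[OF _ sym])
qed

lemma cotorsion_pair_left_unique:
  assumes "cotorsion_pair A \<C> \<F>" "cotorsion_pair A \<C>' \<F>"
  shows "\<C> = \<C>'"
proof -
  have "\<C> = {C \<in> Obj A. \<forall>F \<in> \<F>. Ext1_vanishes A C F}"
    using assms(1) unfolding cotorsion_pair_def by (elim conjE)
  moreover have "\<C>' = {C \<in> Obj A. \<forall>F \<in> \<F>. Ext1_vanishes A C F}"
    using assms(2) unfolding cotorsion_pair_def by (elim conjE)
  ultimately show ?thesis by (rule trans[OF _ sym])
qed

text \<open>
  Each class of a cotorsion pair is defined by the other one.  The rules below break this circle
  into the single implications that it consists of.
\<close>

lemma
  assumes "cotorsion_pair A \<C> \<F>"
  shows cotorsion_pair_left_obj: "C \<in> \<C> \<Longrightarrow> C \<in> Obj A"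
    and cotorsion_pair_right_obj: "F \<in> \<F> \<Longrightarrow> F \<in> Obj A"
    and cotorsion_pair_vanishes: "C \<in> \<C> \<Longrightarrow> F \<in> \<F> \<Longrightarrow> Ext1_vanishes A C F"
    and cotorsion_pair_rightI:
      "X \<in> Obj A \<Longrightarrow> (\<And>C. C \<in> \<C> \<Longrightarrow> Ext1_vanishes A C X) \<Longrightarrow> X \<in> \<F>"
    and cotorsion_pair_leftI:
      "X \<in> Obj A \<Longrightarrow> (\<And>F. F \<in> \<F> \<Longrightarrow> Ext1_vanishes A X F) \<Longrightarrow> X \<in> \<C>"
  using assms unfolding cotorsion_pair_def by blast+

lemma cotorsion_pairI:
  assumes "\<C> \<subseteq> Obj A" "\<F> \<subseteq> Obj A"
    and "\<And>C F. C \<in> \<C> \<Longrightarrow> F \<in> \<F> \<Longrightarrow> Ext1_vanishes A C F"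
    and "\<And>X. X \<in> Obj A \<Longrightarrow> (\<And>C. C \<in> \<C> \<Longrightarrow> Ext1_vanishes A C X) \<Longrightarrow> X \<in> \<F>"
    and "\<And>X. X \<in> Obj A \<Longrightarrow> (\<And>F. F \<in> \<F> \<Longrightarrow> Ext1_vanishes A X F) \<Longrightarrow> X \<in> \<C>"
  shows "cotorsion_pair A \<C> \<F>"
  unfolding cotorsion_pair_def using assms by blast

lemma (in exact_category) cotorsion_pair_opposite:
  assumes "cotorsion_pair A \<C> \<F>"
  shows "cotorsion_pair (opposite A) \<F> \<C>"
proof (rule cotorsion_pairI)
  note obj = cotorsion_pair_left_obj[OF assms] cotorsion_pair_right_obj[OF assms]
  show "\<F> \<subseteq> Obj (opposite A)" "\<C> \<subseteq> Obj (opposite A)" using obj by auto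
  show "Ext1_vanishes (opposite A) F C" if "F \<in> \<F>" "C \<in> \<C>" for F C
    using cotorsion_pair_vanishes[OF assms] Ext1_vanishes_opposite obj that by blast
  show "X \<in> \<C>" if "X \<in> Obj (opposite A)" "\<And>F. F \<in> \<F> \<Longrightarrow> Ext1_vanishes (opposite A) F X" for X
    using that Ext1_vanishes_opposite obj by (intro cotorsion_pair_leftI[OF assms]) auto
  show "X \<in> \<F>" if "X \<in> Obj (opposite A)" "\<And>C. C \<in> \<C> \<Longrightarrow> Ext1_vanishes (opposite A) X C" for X
    using that Ext1_vanishes_opposite obj by (intro cotorsion_pair_rightI[OF assms]) auto
qed

lemma complete_pair_opposite [simp]:
  "complete_pair (opposite A) \<F> \<C> = complete_pair A \<C> \<F>"
  unfolding complete_pair_def opposite_simps opposite_short_exact by blast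

lemma hereditary_pair_opposite [simp]:
  "hereditary_pair (opposite A) \<F> \<C> = hereditary_pair A \<C> \<F>"
  unfolding hereditary_pair_def opposite_short_exact by blast

context exact_category
begin

lemma cotorsion_pair_right_extension:
  assumes "cotorsion_pair A \<C> \<F>" "short_exact A X Y Z" "X \<in> \<F>" "Z \<in> \<F>"
  shows "Y \<in> \<F>"
proof (rule cotorsion_pair_rightI[OF assms(1) short_exact_obj(2)[OF assms(2)]])
  show "Ext1_vanishes A C Y" if "C \<in> \<C>" for C
    using cotorsion_pair_left_obj[OF assms(1)] cotorsion_pair_vanishes[OF assms(1)] assms(3,4) that
    by (blast intro: Ext1_vanishes_extension_right[OF _ assms(2)])
qed

lemma cotorsion_pair_left_extension:
  assumes "cotorsion_pair A \<C> \<F>" "short_exact A X Y Z" "X \<in> \<C>" "Z \<in> \<C>"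
  shows "Y \<in> \<C>"
  using exact_category.cotorsion_pair_right_extension[OF exact_category_opposite
      cotorsion_pair_opposite[OF assms(1)], of Z Y X] assms by simp

lemma cotorsion_pair_right_retract:
  assumes "cotorsion_pair A \<C> \<F>" "is_retract A X Y" "Y \<in> \<F>"
  shows "X \<in> \<F>"
proof (rule cotorsion_pair_rightI[OF assms(1)])
  show "X \<in> Obj A" using assms(2) by (auto simp: is_retract_def homs_def)
  show "Ext1_vanishes A C X" if "C \<in> \<C>" for C
    using cotorsion_pair_left_obj[OF assms(1)] cotorsion_pair_vanishes[OF assms(1)] assms(3) that
    by (blast intro: Ext1_vanishes_retract[OF _ assms(2)])
qed

end

section \<open>The class of trivial objects\<close>

text \<open>
  The locale is closed under duality: its opposite instance has \<open>\<R>, \<R>t, \<Q>, \<Q>t\<close> in the places of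
  \<open>\<Q>, \<Q>t, \<R>, \<R>t\<close>.
\<close>

locale compatible_cotorsion_pairs = exact_category A
  for A :: "('o, 'm, 'z) exact_data_scheme" (structure) +
  fixes \<Q> \<Q>t \<R> \<R>t :: "'o set"
  assumes cotorsion_Q: "complete_cotorsion_pair A \<Q> \<R>t" and hereditary_Q: "hereditary_pair A \<Q> \<R>t"
    and cotorsion_R: "complete_cotorsion_pair A \<Q>t \<R>" and hereditary_R: "hereditary_pair A \<Q>t \<R>"
    and Rt_subset: "\<R>t \<subseteq> \<R>" and Qt_subset: "\<Q>t \<subseteq> \<Q>"
    and cores_eq: "\<Q>t \<inter> \<R> = \<Q> \<inter> \<R>t"
begin

lemma compatible_cotorsion_pairs_opposite:
  "compatible_cotorsion_pairs (opposite A) \<R> \<R>t \<Q> \<Q>t"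
  using cotorsion_Q hereditary_Q cotorsion_R hereditary_R Rt_subset Qt_subset cores_eq
  by (intro compatible_cotorsion_pairs.intro exact_category_opposite
      compatible_cotorsion_pairs_axioms.intro)
    (auto simp: complete_cotorsion_pair_def intro: cotorsion_pair_opposite)

lemma pair_Q: "cotorsion_pair A \<Q> \<R>t" and pair_R: "cotorsion_pair A \<Q>t \<R>"
  using cotorsion_Q cotorsion_R by (auto simp: complete_cotorsion_pair_def)

lemma R_resolution:
  assumes "X \<in> Obj A"
  obtains R Q where "R \<in> \<R>" "Q \<in> \<Q>t" "short_exact A X R Q"
  using cotorsion_R assms unfolding complete_cotorsion_pair_def complete_pair_def by blast

lemma Q_resolution:
  assumes "X \<in> Obj A"
  obtains R Q where "R \<in> \<R>t" "Q \<in> \<Q>" "short_exact A R Q X"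
  using cotorsion_Q assms unfolding complete_cotorsion_pair_def complete_pair_def by blast

definition trivials :: "'o set" where
  "trivials = {X \<in> Obj A. \<exists>R \<in> \<R>t. \<exists>Q \<in> \<Q>t. short_exact A X R Q}"

definition cotrivials :: "'o set" where
  "cotrivials = {X \<in> Obj A. \<exists>R \<in> \<R>t. \<exists>Q \<in> \<Q>t. short_exact A R Q X}"

lemma trivials_opposite:
  "compatible_cotorsion_pairs.trivials (opposite A) \<R>t \<Q>t = cotrivials"
  unfolding compatible_cotorsion_pairs.trivials_def[OF compatible_cotorsion_pairs_opposite]
    cotrivials_def by auto

lemma cotrivials_opposite:
  "compatible_cotorsion_pairs.cotrivials (opposite A) \<R>t \<Q>t = trivials"
  unfolding compatible_cotorsion_pairs.cotrivials_def[OF compatible_cotorsion_pairs_opposite]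
    trivials_def by auto

text \<open>
  Cover \<open>R\<close> by \<open>Q'\<close> with kernel \<open>R' \<in> \<R>t\<close>.  As an extension of objects of \<open>\<R>t\<close>, \<open>Q'\<close> lies in
  \<open>\<Q> \<inter> \<R>t = \<Q>t \<inter> \<R>\<close>, so the kernel of \<open>Q' \<rightarrow> R \<rightarrow> Q\<close> is in \<open>\<Q>t\<close> by heredity, and it covers \<open>X\<close>.
\<close>

lemma trivials_subset_cotrivials: "trivials \<subseteq> cotrivials"
proof
  fix X assume "X \<in> trivials"
  then obtain R Q where X: "X \<in> Obj A" and R: "R \<in> \<R>t" and Q: "Q \<in> \<Q>t"
    and XR: "short_exact A X R Q" by (auto simp: trivials_def)
  obtain R' Q' where R': "R' \<in> \<R>t" and Q': "Q' \<in> \<Q>" and res: "short_exact A R' Q' R"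
    using Q_resolution[OF short_exact_obj(2)[OF XR]] by blast
  have "Q' \<in> \<R>t" by (rule cotorsion_pair_right_extension[OF pair_Q res R' R])
  then have "Q' \<in> \<Q>t" using Q' cores_eq by blast
  obtain K where K: "short_exact A K Q' Q" "short_exact A R' K X"
    by (rule short_exact_composite_epi[OF res XR])
  then have "K \<in> \<Q>t"
    using hereditary_R \<open>Q' \<in> \<Q>t\<close> Q unfolding hereditary_pair_def by blast
  then show "X \<in> cotrivials" using X R' K(2) by (auto simp: cotrivials_def)
qed

lemma trivials_eq_cotrivials: "trivials = cotrivials"
  using trivials_subset_cotrivials
    compatible_cotorsion_pairs.trivials_subset_cotrivials[OF compatible_cotorsion_pairs_opposite]
  unfolding trivials_opposite cotrivials_opposite by blast

lemma trivials_opposite_eq: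
  "compatible_cotorsion_pairs.trivials (opposite A) \<R>t \<Q>t = trivials"
  unfolding trivials_opposite trivials_eq_cotrivials ..

text \<open>
  Composing with \<open>Y \<rightarrow> R\<close> embeds \<open>X\<close> into the same object of \<open>\<R>t\<close>; the new cokernel is an extension of
  the old one by \<open>Z\<close>.
\<close>

lemma kernel_trivials_Qt:
  assumes se: "short_exact A X Y Z" and Y: "Y \<in> trivials" and Z: "Z \<in> \<Q>t"
  shows "X \<in> trivials"
proof -
  obtain R Q where R: "R \<in> \<R>t" and Q: "Q \<in> \<Q>t" and YR: "short_exact A Y R Q"
    using Y by (auto simp: trivials_def)
  obtain W where W: "short_exact A X R W" "short_exact A Z W Q"
    by (rule short_exact_composite_mono[OF se YR])
  have "W \<in> \<Q>t" by (rule cotorsion_pair_left_extension[OF pair_R W(2) Z Q])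
  then show ?thesis using W(1) R short_exact_obj(1)[OF se] by (auto simp: trivials_def)
qed

lemma cokernel_Rt_trivials:
  assumes "short_exact A X Y Z" "Y \<in> trivials" "X \<in> \<R>t"
  shows "Z \<in> trivials"
  using compatible_cotorsion_pairs.kernel_trivials_Qt[OF compatible_cotorsion_pairs_opposite,
      of Z Y X] assms
  unfolding trivials_opposite_eq by simp

text \<open>
  Embed \<open>Y\<close> into \<open>R \<in> \<R>\<close> with cokernel \<open>Q \<in> \<Q>t\<close>.  The quotient \<open>W = R/X\<close> lies in \<open>\<R>\<close> by heredity and in
  \<open>\<Q>t\<close> as an extension of \<open>Q\<close> by \<open>Z\<close>, hence in \<open>\<R>t\<close>; and then so does \<open>R\<close>, an extension of \<open>W\<close> by \<open>X\<close>.
\<close>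

lemma extension_Rt_Qt_trivials:
  assumes se: "short_exact A X Y Z" and X: "X \<in> \<R>t" and Z: "Z \<in> \<Q>t"
  shows "Y \<in> trivials"
proof -
  obtain R Q where R: "R \<in> \<R>" and Q: "Q \<in> \<Q>t" and YR: "short_exact A Y R Q"
    using R_resolution[OF short_exact_obj(2)[OF se]] by blast
  obtain W where W: "short_exact A X R W" "short_exact A Z W Q"
    by (rule short_exact_composite_mono[OF se YR])
  have "W \<in> \<Q>t" by (rule cotorsion_pair_left_extension[OF pair_R W(2) Z Q])
  moreover have "W \<in> \<R>"
    using hereditary_R W(1) X R Rt_subset unfolding hereditary_pair_def by blast
  ultimately have "W \<in> \<R>t" using cores_eq by blast
  then have "R \<in> \<R>t" by (rule cotorsion_pair_right_extension[OF pair_Q W(1) X])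
  then show ?thesis using YR Q short_exact_obj(1)[OF YR] by (auto simp: trivials_def)
qed

text \<open>
  With \<open>X \<rightarrow> R \<rightarrow> Q\<close> and \<open>R' \<rightarrow> Q' \<rightarrow> Z\<close>, the pushout \<open>R \<rightarrow> P \<rightarrow> Z\<close> followed by the pullback
  \<open>R \<rightarrow> P' \<rightarrow> Q'\<close> replaces the outer terms by \<open>R\<close> and \<open>Q'\<close>.  The way back from \<open>P'\<close> to \<open>Y\<close> is the
  cokernel \<open>P\<close> of \<open>R' \<rightarrow> P'\<close> and the kernel \<open>Y\<close> of \<open>P \<rightarrow> Q\<close>.
\<close>

lemma extension_trivials:
  assumes se: "short_exact A X Y Z" and X: "X \<in> trivials" and Z: "Z \<in> trivials"
  shows "Y \<in> trivials"
proof -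
  obtain R Q where R: "R \<in> \<R>t" and Q: "Q \<in> \<Q>t" and XR: "short_exact A X R Q"
    using X by (auto simp: trivials_def)
  obtain R' Q' where R': "R' \<in> \<R>t" and Q': "Q' \<in> \<Q>t" and ZR: "short_exact A R' Q' Z"
    using Z unfolding trivials_eq_cotrivials by (auto simp: cotrivials_def)
  obtain P where P: "short_exact A R P Z" "short_exact A Y P Q"
    by (rule short_exact_pushout[OF se XR])
  obtain P' where P': "short_exact A R P' Q'" "short_exact A R' P' P"
    by (rule short_exact_pullback[OF P(1) ZR])
  have "P' \<in> trivials" by (rule extension_Rt_Qt_trivials[OF P'(1) R Q'])
  then have "P \<in> trivials" by (rule cokernel_Rt_trivials[OF P'(2) _ R'])
  then show ?thesis by (rule kernel_trivials_Qt[OF P(2) _ Q])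
qed

text \<open>
  If \<open>X \<in> \<Q>t\<close>, then in \<open>X \<rightarrow> R \<rightarrow> Q\<close> the middle term is in \<open>\<Q>t \<inter> \<R> = \<Q> \<inter> \<R>t\<close>.
\<close>

lemma Qt_subset_trivials: "\<Q>t \<subseteq> trivials"
proof
  fix X assume X: "X \<in> \<Q>t"
  then have "X \<in> Obj A" by (rule cotorsion_pair_left_obj[OF pair_R])
  then obtain R Q where R: "R \<in> \<R>" and Q: "Q \<in> \<Q>t" and XR: "short_exact A X R Q"
    by (rule R_resolution)
  have "R \<in> \<Q>t" by (rule cotorsion_pair_left_extension[OF pair_R XR X Q])
  then have "R \<in> \<R>t" using R cores_eq by blast
  then show "X \<in> trivials" using Q XR \<open>X \<in> Obj A\<close> by (auto simp: trivials_def)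
qed

text \<open>
  If \<open>X \<in> \<Q>\<close>, then in \<open>X \<rightarrow> R \<rightarrow> Q\<close> with \<open>R \<in> \<R>t\<close> the middle term is in \<open>\<Q> \<inter> \<R>t = \<Q>t \<inter> \<R>\<close>, and heredity
  of \<open>(\<Q>t, \<R>)\<close> passes to the kernel.
\<close>

lemma Q_trivials_subset_Qt: "\<Q> \<inter> trivials \<subseteq> \<Q>t"
proof
  fix X assume "X \<in> \<Q> \<inter> trivials"
  then obtain R Q where X: "X \<in> \<Q>" and R: "R \<in> \<R>t" and Q: "Q \<in> \<Q>t"
    and XR: "short_exact A X R Q"
    by (auto simp: trivials_def)
  have "R \<in> \<Q>" by (rule cotorsion_pair_left_extension[OF pair_Q XR X]) (use Q Qt_subset in blast)
  then have "R \<in> \<Q>t" using R cores_eq by blast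
  then show "X \<in> \<Q>t" using hereditary_R XR Q unfolding hereditary_pair_def by blast
qed

lemma Q_inter_trivials: "\<Q> \<inter> trivials = \<Q>t"
  using Qt_subset_trivials Q_trivials_subset_Qt Qt_subset by blast

lemma trivials_inter_R: "trivials \<inter> \<R> = \<R>t"
  using compatible_cotorsion_pairs.Q_inter_trivials[OF compatible_cotorsion_pairs_opposite]
  unfolding trivials_opposite_eq by blast

text \<open>
  The pushout \<open>R \<rightarrow> P \<rightarrow> Z\<close> along \<open>X \<rightarrow> R\<close> presents \<open>Z\<close> as a cokernel from \<open>\<R>t\<close>, and \<open>P\<close> is an extension
  of \<open>Q\<close> by \<open>Y\<close>.
\<close>

lemma cokernel_trivials:
  assumes se: "short_exact A X Y Z" and X: "X \<in> trivials" and Y: "Y \<in> trivials"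
  shows "Z \<in> trivials"
proof -
  obtain R Q where R: "R \<in> \<R>t" and Q: "Q \<in> \<Q>t" and XR: "short_exact A X R Q"
    using X by (auto simp: trivials_def)
  obtain P where P: "short_exact A R P Z" "short_exact A Y P Q"
    by (rule short_exact_pushout[OF se XR])
  have "P \<in> trivials" by (rule extension_trivials[OF P(2) Y]) (use Q Qt_subset_trivials in blast)
  then show ?thesis by (rule cokernel_Rt_trivials[OF P(1) _ R])
qed

lemma kernel_trivials:
  assumes "short_exact A X Y Z" "Y \<in> trivials" "Z \<in> trivials"
  shows "X \<in> trivials"
  using compatible_cotorsion_pairs.cokernel_trivials[OF compatible_cotorsion_pairs_opposite,
      of Z Y X] assms
  unfolding trivials_opposite_eq by simp

text \<open>
  In \<open>X \<rightarrow> R \<rightarrow> Q\<close> with \<open>R \<in> \<R>\<close> it has to be seen that \<open>R \<in> \<R>t\<close>.  The pushout makes \<open>R\<close> a retract of a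
  trivial \<open>P\<close>, which need not lie in \<open>\<R>\<close>; but the retraction \<open>P \<rightarrow> R\<close> extends along an embedding
  \<open>P \<rightarrow> R'\<close> with cokernel in \<open>\<Q>t\<close>, so that \<open>R\<close> is even a retract of \<open>R' \<in> trivials \<inter> \<R> = \<R>t\<close>.
\<close>

lemma retract_trivials:
  assumes ret: "is_retract A X Y" and Y: "Y \<in> trivials"
  shows "X \<in> trivials"
proof -
  have X: "X \<in> Obj A" using ret by (auto simp: is_retract_def homs_def)
  obtain R Q where R: "R \<in> \<R>" and Q: "Q \<in> \<Q>t" and XR: "short_exact A X R Q"
    using R_resolution[OF X] by blast
  obtain P where P: "short_exact A Y P Q" "is_retract A R P"
    by (rule short_exact_pushout_retract[OF ret XR])
  obtain R' Q' where R': "R' \<in> \<R>" and Q': "Q' \<in> \<Q>t" and PR: "short_exact A P R' Q'"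
    using R_resolution[OF short_exact_obj(2)[OF P(1)]] by blast
  have "P \<in> trivials"
    by (rule extension_trivials[OF P(1) Y]) (use Q Qt_subset_trivials in blast)
  then have "R' \<in> trivials"
    by (rule extension_trivials[OF PR]) (use Q' Qt_subset_trivials in blast)
  then have "R' \<in> \<R>t" using R' trivials_inter_R by blast
  have "is_retract A R R'"
  proof -
    obtain s r where sr: "s \<in> homs A R P" "r \<in> homs A P R" "r \<cdot> s = idm A R"
      using P(2) by (auto simp: is_retract_def)
    obtain j q where jq: "j \<in> homs A P R'" "q \<in> homs A R' Q'" "(j, q) \<in> Ses A"
      using PR by (auto simp: short_exact_def)
    have "Ext1_vanishes A Q' R" by (rule cotorsion_pair_vanishes[OF pair_R Q' R])
    then obtain g where g: "g \<in> homs A R' R" "g \<cdot> j = r"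
      by (rule_tac Ext1_vanishes_extend[OF jq(3), of R r])
        (use jq sr in \<open>auto simp: homs_def\<close>)
    have "g \<cdot> (j \<cdot> s) = idm A R"
      using cmp_cong_assoc[OF g(2), of s] sr jq g(1) by (auto simp: homs_def)
    moreover have "j \<cdot> s \<in> homs A R R'" using cmp_hom[OF sr(1) jq(1)] .
    ultimately show ?thesis using g(1) unfolding is_retract_def by blast
  qed
  then have "R \<in> \<R>t" by (rule cotorsion_pair_right_retract[OF pair_Q _ \<open>R' \<in> \<R>t\<close>])
  then show ?thesis using X Q XR by (auto simp: trivials_def)
qed

lemma thick_trivials: "thick A trivials"
  unfolding thick_def
proof (intro conjI allI impI)
  show "trivials \<subseteq> Obj A" by (auto simp: trivials_def)
qed (blast intro: retract_trivials extension_trivials cokernel_trivials kernel_trivials)+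

lemma Hovey_triple_trivials: "Hovey_triple A \<Q> trivials \<R>"
  using thick_trivials cotorsion_Q cotorsion_R
  unfolding Hovey_triple_def trivials_inter_R Q_inter_trivials by (intro conjI)

text \<open>
  The two cotorsion pairs force \<open>\<W> \<inter> \<R> = \<R>t\<close> and \<open>\<Q> \<inter> \<W> = \<Q>t\<close>; two out of three for
  \<open>X \<rightarrow> R \<rightarrow> Q\<close> with \<open>Q \<in> \<Q>t\<close> then decides membership of \<open>X\<close>.
\<close>

lemma Hovey_triple_unique:
  assumes H: "Hovey_triple A \<Q> \<W> \<R>"
  shows "\<W> = trivials"
proof -
  have thick: "thick A \<W>" and "cotorsion_pair A \<Q> (\<W> \<inter> \<R>)" "cotorsion_pair A (\<Q> \<inter> \<W>) \<R>"
    using H unfolding Hovey_triple_def complete_cotorsion_pair_def by blast+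
  then have WR: "\<W> \<inter> \<R> = \<R>t" and QW: "\<Q> \<inter> \<W> = \<Q>t"
    by (auto dest: cotorsion_pair_right_unique[OF pair_Q] cotorsion_pair_left_unique[OF pair_R])
  show ?thesis
  proof (intro equalityI subsetI)
    fix X assume X: "X \<in> \<W>"
    then have "X \<in> Obj A" using thick by (auto simp: thick_def)
    then obtain R Q where R: "R \<in> \<R>" and Q: "Q \<in> \<Q>t" and XR: "short_exact A X R Q"
      by (rule R_resolution)
    have "R \<in> \<W>" using thick XR X Q QW unfolding thick_def by blast
    then have "R \<in> \<R>t" using R WR by blast
    then show "X \<in> trivials" using \<open>X \<in> Obj A\<close> Q XR by (auto simp: trivials_def)
  next
    fix X assume "X \<in> trivials"
    then obtain R Q where "R \<in> \<R>t" "Q \<in> \<Q>t" "short_exact A X R Q"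
      by (auto simp: trivials_def)
    moreover from this have "R \<in> \<W>" "Q \<in> \<W>" using WR QW by auto
    ultimately show "X \<in> \<W>" using thick unfolding thick_def by blast
  qed
qed

end

theorem theorem1p1:
  fixes A :: "('o, 'm) exact_data"
    and \<Q> \<Q>t \<R> \<R>t :: "'o set"
  assumes "wic_exact_category A"
    and "complete_cotorsion_pair A \<Q> \<R>t" and "hereditary_pair A \<Q> \<R>t"
    and "complete_cotorsion_pair A \<Q>t \<R>" and "hereditary_pair A \<Q>t \<R>"
    and "\<R>t \<subseteq> \<R>" and "\<Q>t \<subseteq> \<Q>"
    and "\<Q>t \<inter> \<R> = \<Q> \<inter> \<R>t"
  shows "(\<exists>!\<W>. thick A \<W> \<and> Hovey_triple A \<Q> \<W> \<R>) \<and>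
    (\<forall>\<W>. thick A \<W> \<and> Hovey_triple A \<Q> \<W> \<R> \<longrightarrow>
       \<W> = {X \<in> Obj A. \<exists>R \<in> \<R>t. \<exists>Q \<in> \<Q>t. short_exact A X R Q} \<and>
       \<W> = {X \<in> Obj A. \<exists>R' \<in> \<R>t. \<exists>Q' \<in> \<Q>t. short_exact A R' Q' X})"
proof -
  interpret wic_exact_category A by fact
  interpret compatible_cotorsion_pairs A \<Q> \<Q>t \<R> \<R>t
    using assms by unfold_locales
  have "\<exists>!\<W>. thick A \<W> \<and> Hovey_triple A \<Q> \<W> \<R>"
    using thick_trivials Hovey_triple_trivials Hovey_triple_unique by blast
  moreover have "\<forall>\<W>. thick A \<W> \<and> Hovey_triple A \<Q> \<W> \<R> \<longrightarrow>
      \<W> = {X \<in> Obj A. \<exists>R \<in> \<R>t. \<exists>Q \<in> \<Q>t. short_exact A X R Q} \<and>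
      \<W> = {X \<in> Obj A. \<exists>R' \<in> \<R>t. \<exists>Q' \<in> \<Q>t. short_exact A R' Q' X}"
    using Hovey_triple_unique trivials_eq_cotrivials
    unfolding trivials_def[symmetric] cotrivials_def[symmetric] by blast
  ultimately show ?thesis by (rule conjI)
qed

end
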